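(* Let $W$ be a kernel on a probability space $(S,\mu)$ with at least one measurable order. Then the following are equivalent. (i) $\Omega(W)=0$. (ii) There exists a measurable order $\prec$ on $S$ such that $W$ is a.e. equal to a monotone kernel on $(S,\prec)$. (iii) $W$ is equivalent to a monotone kernel on some ordered probability space. (iv) $W$ is equivalent to a monotone kernel on $[0,1]$ (with Lebesgue measure and the standard order). (v) $\Gamma_W$ is a monotone graph limit.
   Context: A measurable order on a probability space $(S,\mathcal F,\mu)$ is a (strict) linear order $\prec$ on $S$ such that $\{(x,y):x\prec y\}$ is a measurable subset of $S\times S$ (with the product $\sigma$-field); then $(S,\mu,\prec)$ is called an ordered probability space. A kernel on $S$ is a symmetric measurable function $W:S^2\to[0,1]$. It is monotone on $(S,\prec)$ if $W(x_1,y_1)\le W(x_2,y_2)$ whenever $x_1\preceq x_2$ and $y_1\preceq y_2$. For a kernel $W$ on $S$, a measurable order $\prec$ and a measurable set $A\subseteq S$, let $$\Omega_1(W,\prec,A)=\iint_{x\prec y}\Bigl(\int_A W(x,z)\,d\mu(z)-\int_A W(y,z)\,d\mu(z)\Bigr)_+\,d\mu(x)\,d\mu(y),$$ where $t_+=\max\{t,0\}$; let $\Omega_1(W,\prec)=\sup_{A}\Omega_1(W,\prec,A)$ over measurable $A\subseteq S$, and $\Omega_1(W)=\inf_\prec\Omega_1(W,\prec)$ over all measurable orders on $S$. Here $\Omega(W)$ means $\Omega_1(W)$. For $W\in L^1(S^2)$ the cut norm is $\|W\|_{\square}=\sup\bigl|\int_{S^2}W(x,y)f(x)g(y)\,d\mu(x)\,d\mu(y)\bigr|$,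 the supremum being over measurable $f,g:S\to[-1,1]$. For kernels $W_1$ on $S_1$ and $W_2$ on $S_2$, $\delta_\square(W_1,W_2)=\inf\|W_1^{\varphi_1}-W_2^{\varphi_2}\|_\square$, the infimum being over all pairs of measure-preserving maps $\varphi_1:S_3\to S_1$, $\varphi_2:S_3\to S_2$ from a common probability space $S_3$, where $W^\varphi(x,y)=W(\varphi(x),\varphi(y))$. Kernels with $\delta_\square(W_1,W_2)=0$ are called equivalent. Graph limits are identified with equivalence classes of kernels, $\Gamma_W$ denoting the class of $W$. A graph limit is monotone if it is of the form $\Gamma_{W'}$ with $W'$ a monotone kernel on $[0,1]$. *)

theory Defs
  imports "HOL-Probability.Probability"
begin

section \<open>Ordered probability spaces and kernels\<close>

text \<open>An order is represented by its graph, the set of pairs with first component strictly below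
  the second one; membership in the product sigma-algebra forces it to live on \<open>space M\<close>.\<close>

definition measurable_order :: "'a measure \<Rightarrow> ('a \<times> 'a) set \<Rightarrow> bool" where
  "measurable_order M r \<longleftrightarrow>
     strict_linear_order_on (space M) r \<and> r \<in> sets (M \<Otimes>\<^sub>M M)"

definition ordered_prob_space :: "'a measure \<Rightarrow> ('a \<times> 'a) set \<Rightarrow> bool" where
  "ordered_prob_space M r \<longleftrightarrow> prob_space M \<and> measurable_order M r"

definition kernel_on :: "'a measure \<Rightarrow> ('a \<Rightarrow> 'a \<Rightarrow> real) \<Rightarrow> bool" where
  "kernel_on M W \<longleftrightarrow>
     (\<lambda>(x, y). W x y) \<in> borel_measurable (M \<Otimes>\<^sub>M M) \<and>
     (\<forall>x\<in>space M. \<forall>y\<in>space M. W x y = W y x \<and> W x y \<in> {0..1})"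

definition monotone_kernel ::
    "'a measure \<Rightarrow> ('a \<times> 'a) set \<Rightarrow> ('a \<Rightarrow> 'a \<Rightarrow> real) \<Rightarrow> bool" where
  "monotone_kernel M r W \<longleftrightarrow> kernel_on M W \<and>
     (\<forall>x1\<in>space M. \<forall>x2\<in>space M. \<forall>y1\<in>space M. \<forall>y2\<in>space M.
        (x1, x2) \<in> r\<^sup>= \<longrightarrow> (y1, y2) \<in> r\<^sup>= \<longrightarrow> W x1 y1 \<le> W x2 y2)"

section \<open>The functional \<open>\<Omega>\<^sub>1\<close>\<close>

definition Omega1_on ::
    "'a measure \<Rightarrow> ('a \<Rightarrow> 'a \<Rightarrow> real) \<Rightarrow> ('a \<times> 'a) set \<Rightarrow> 'a set \<Rightarrow> real" where
  "Omega1_on M W r A =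
     set_lebesgue_integral (M \<Otimes>\<^sub>M M) r
       (\<lambda>(x, y). max ((LINT z:A|M. W x z) - (LINT z:A|M. W y z)) 0)"

definition Omega1_order ::
    "'a measure \<Rightarrow> ('a \<Rightarrow> 'a \<Rightarrow> real) \<Rightarrow> ('a \<times> 'a) set \<Rightarrow> real" where
  "Omega1_order M W r = (SUP A\<in>sets M. Omega1_on M W r A)"

definition Omega1 :: "'a measure \<Rightarrow> ('a \<Rightarrow> 'a \<Rightarrow> real) \<Rightarrow> real" where
  "Omega1 M W = (INF r\<in>{r. measurable_order M r}. Omega1_order M W r)"

section \<open>Cut norm, cut distance, equivalence\<close>

definition cut_test :: "'a measure \<Rightarrow> ('a \<Rightarrow> real) set" where
  "cut_test M = {f \<in> borel_measurable M. \<forall>x\<in>space M. f x \<in> {-1..1}}"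

definition cut_norm :: "'a measure \<Rightarrow> ('a \<Rightarrow> 'a \<Rightarrow> real) \<Rightarrow> real" where
  "cut_norm M U = (SUP (f, g)\<in>cut_test M \<times> cut_test M.
     \<bar>LINT (x, y)|(M \<Otimes>\<^sub>M M). U x y * f x * g y\<bar>)"

definition measure_preserving :: "'c measure \<Rightarrow> 'a measure \<Rightarrow> ('c \<Rightarrow> 'a) \<Rightarrow> bool" where
  "measure_preserving N M \<phi> \<longleftrightarrow> \<phi> \<in> measurable N M \<and> distr N M \<phi> = M"

definition pullback :: "('a \<Rightarrow> 'a \<Rightarrow> real) \<Rightarrow> ('c \<Rightarrow> 'a) \<Rightarrow> 'c \<Rightarrow> 'c \<Rightarrow> real" where
  "pullback W \<phi> = (\<lambda>x y. W (\<phi> x) (\<phi> y))"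

text \<open>The common domain \<open>N\<close> of the two maps ranges over all probability spaces carried by the type
  \<open>'a \<times> 'b\<close>. The lemma \<open>cut_dist_le\<close> below shows that nothing is lost: probability
  spaces over any other type do not lower the infimum.\<close>

definition cut_dist ::
    "'a measure \<Rightarrow> ('a \<Rightarrow> 'a \<Rightarrow> real) \<Rightarrow> 'b measure \<Rightarrow> ('b \<Rightarrow> 'b \<Rightarrow> real) \<Rightarrow> real" where
  "cut_dist M1 W1 M2 W2 =
     (INF (N, \<phi>1, \<phi>2)\<in>{(N :: ('a \<times> 'b) measure, \<phi>1, \<phi>2).
            prob_space N \<and> measure_preserving N M1 \<phi>1 \<and> measure_preserving N M2 \<phi>2}.
        cut_norm N (\<lambda>x y. pullback W1 \<phi>1 x y - pullback W2 \<phi>2 x y))"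

definition kernel_equiv ::
    "'a measure \<Rightarrow> ('a \<Rightarrow> 'a \<Rightarrow> real) \<Rightarrow> 'b measure \<Rightarrow> ('b \<Rightarrow> 'b \<Rightarrow> real) \<Rightarrow> bool" where
  "kernel_equiv M1 W1 M2 W2 \<longleftrightarrow> cut_dist M1 W1 M2 W2 = 0"

text \<open>HOL cannot quantify over types inside a formula, so the type carrying the ordered probability
  space is a parameter. Equivalence of a proposition \<open>P\<close> with the existence of such a space over some
  type amounts to: \<open>P\<close> follows from existence over an arbitrary type, and \<open>P\<close> implies existence over
  one particular type.\<close>

definition equiv_monotone_kernel ::
    "'b itself \<Rightarrow> 'a measure \<Rightarrow> ('a \<Rightarrow> 'a \<Rightarrow> real) \<Rightarrow> bool" where
  "equiv_monotone_kernel _ M W \<longleftrightarrow>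
     (\<exists>(N :: 'b measure) r V. ordered_prob_space N r \<and> monotone_kernel N r V \<and> kernel_equiv M W N V)"

section \<open>The unit interval and graph limits\<close>

definition unit_interval :: "real measure" where
  "unit_interval = restrict_space lborel {0..1}"

definition unit_order :: "(real \<times> real) set" where
  "unit_order = {(x, y). 0 \<le> x \<and> x < y \<and> y \<le> 1}"

text \<open>A class of kernels over all probability spaces is not an object of HOL; the class of \<open>W\<close> is
  represented by its members on probability spaces carried by the reals. As every kernel is equivalent
  to one on \<open>[0,1]\<close>, this set is nonempty and determines the whole class.\<close>

definition graph_limit ::
    "'a measure \<Rightarrow> ('a \<Rightarrow> 'a \<Rightarrow> real) \<Rightarrow> (real measure \<times> (real \<Rightarrow> real \<Rightarrow> real)) set" where
  "graph_limit M W = {(N, V). prob_space N \<and> kernel_on N V \<and> kernel_equiv M W N V}"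

definition monotone_graph_limit :: "(real measure \<times> (real \<Rightarrow> real \<Rightarrow> real)) set \<Rightarrow> bool" where
  "monotone_graph_limit G \<longleftrightarrow>
     (\<exists>V. monotone_kernel unit_interval unit_order V \<and> G = graph_limit unit_interval V)"

section \<open>Consistency of the definitions\<close>

lemma ordered_prob_space_unit_interval: "ordered_prob_space unit_interval unit_order"
proof -
  have "prob_space unit_interval"
    unfolding unit_interval_def by (rule prob_space_restrict_space) auto
  moreover have "strict_linear_order_on (space unit_interval) unit_order"
    by (auto simp: strict_linear_order_on_def trans_def irrefl_def total_on_def
        unit_interval_def unit_order_def space_restrict_space)
  moreover have "unit_order \<in> sets (unit_interval \<Otimes>\<^sub>M unit_interval)"
  proof -
    have [measurable]: "(\<lambda>x. x) \<in> borel_measurable unit_interval"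
      unfolding unit_interval_def by (intro measurable_restrict_space1) simp
    have "{p \<in> space (unit_interval \<Otimes>\<^sub>M unit_interval). fst p < snd p}
          \<in> sets (unit_interval \<Otimes>\<^sub>M unit_interval)"
      by measurable
    moreover have "{p \<in> space (unit_interval \<Otimes>\<^sub>M unit_interval). fst p < snd p} = unit_order"
      by (auto simp: space_pair_measure unit_interval_def unit_order_def space_restrict_space)
    ultimately show ?thesis by simp
  qed
  ultimately show ?thesis
    by (simp add: ordered_prob_space_def measurable_order_def)
qed

lemma zero_in_cut_test: "(\<lambda>_. 0) \<in> cut_test M"
  by (simp add: cut_test_def)

lemma cut_norm_bdd:
  assumes "prob_space N" and B: "\<And>x y. x \<in> space N \<Longrightarrow> y \<in> space N \<Longrightarrow> \<bar>U x y\<bar> \<le> B"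
  shows "bdd_above ((\<lambda>(f, g). \<bar>LINT (x, y)|(N \<Otimes>\<^sub>M N). U x y * f x * g y\<bar>)
           ` (cut_test N \<times> cut_test N))"
proof -
  interpret prob_space N by fact
  interpret P: pair_prob_space N N ..
  have "\<bar>LINT (x, y)|(N \<Otimes>\<^sub>M N). U x y * f x * g y\<bar> \<le> B"
    if "f \<in> cut_test N" "g \<in> cut_test N" for f g
  proof -
    obtain z where z: "z \<in> space N" using not_empty by auto
    have B0: "0 \<le> B" using B[OF z z] by linarith
    have b: "\<bar>U x y * f x * g y\<bar> \<le> B" if "x \<in> space N" "y \<in> space N" for x y
    proof -
      have "\<bar>f x\<bar> \<le> 1" "\<bar>g y\<bar> \<le> 1"
        using \<open>f \<in> cut_test N\<close> \<open>g \<in> cut_test N\<close> that by (auto simp: cut_test_def abs_le_iff)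
      then have "\<bar>U x y\<bar> * \<bar>f x\<bar> * \<bar>g y\<bar> \<le> B * 1 * 1"
        using B[OF that] B0 by (intro mult_mono) auto
      then show ?thesis by (simp add: abs_mult)
    qed
    show ?thesis
    proof (cases "integrable (N \<Otimes>\<^sub>M N) (\<lambda>(x, y). U x y * f x * g y)")
      case True
      have "\<bar>LINT (x, y)|(N \<Otimes>\<^sub>M N). U x y * f x * g y\<bar>
            \<le> (LINT p|(N \<Otimes>\<^sub>M N). \<bar>case p of (x, y) \<Rightarrow> U x y * f x * g y\<bar>)"
        by (rule integral_abs_bound)
      also have "\<dots> \<le> (LINT p|(N \<Otimes>\<^sub>M N). B)"
        using True b by (intro integral_mono) (auto simp: space_pair_measure)
      finally show ?thesis by (simp add: P.prob_space)
    next
      case False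
      then show ?thesis using B0 by (simp add: not_integrable_integral_eq)
    qed
  qed
  then show ?thesis by (intro bdd_aboveI[of _ B]) auto
qed

lemma cut_norm_nonneg:
  assumes "prob_space N" and "\<And>x y. x \<in> space N \<Longrightarrow> y \<in> space N \<Longrightarrow> \<bar>U x y\<bar> \<le> B"
  shows "0 \<le> cut_norm N U"
proof -
  have "bdd_above ((\<lambda>(f, g). \<bar>LINT (x, y)|(N \<Otimes>\<^sub>M N). U x y * f x * g y\<bar>)
          ` (cut_test N \<times> cut_test N))"
    using assms by (rule cut_norm_bdd)
  then show ?thesis
    unfolding cut_norm_def
    by (rule cSUP_upper2[where x = "(\<lambda>_. 0, \<lambda>_. 0)"]) (auto simp: zero_in_cut_test)
qed

lemma kernel_diff_bound:
  assumes "kernel_on M1 W1" "kernel_on M2 W2" "measure_preserving N M1 \<phi>1" "measure_preserving N M2 \<phi>2"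
    and "x \<in> space N" "y \<in> space N"
  shows "\<bar>pullback W1 \<phi>1 x y - pullback W2 \<phi>2 x y\<bar> \<le> 1"
proof -
  have "\<phi>1 x \<in> space M1" "\<phi>1 y \<in> space M1" "\<phi>2 x \<in> space M2" "\<phi>2 y \<in> space M2"
    using assms by (auto simp: measure_preserving_def dest: measurable_space)
  then have "W1 (\<phi>1 x) (\<phi>1 y) \<in> {0..1}" "W2 (\<phi>2 x) (\<phi>2 y) \<in> {0..1}"
    using assms(1,2) by (auto simp: kernel_on_def)
  then show ?thesis by (auto simp: pullback_def)
qed

lemma cut_dist_le:
  fixes M1 :: "'a measure" and M2 :: "'b measure" and N :: "'c measure"
  assumes k: "kernel_on M1 W1" "kernel_on M2 W2" and N: "prob_space N"
    and mp: "measure_preserving N M1 \<phi>1" "measure_preserving N M2 \<phi>2"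
  shows "cut_dist M1 W1 M2 W2 \<le> cut_norm N (\<lambda>x y. pullback W1 \<phi>1 x y - pullback W2 \<phi>2 x y)"
    (is "_ \<le> cut_norm N ?U")
proof -
  interpret N: prob_space N by fact
  have m[measurable]: "\<phi>1 \<in> measurable N M1" "\<phi>2 \<in> measurable N M2"
    using mp by (auto simp: measure_preserving_def)
  define \<phi> where "\<phi> = (\<lambda>x. (\<phi>1 x, \<phi>2 x))"
  have \<phi>[measurable]: "\<phi> \<in> measurable N (M1 \<Otimes>\<^sub>M M2)" unfolding \<phi>_def by measurable
  define Q where "Q = distr N (M1 \<Otimes>\<^sub>M M2) \<phi>"
  have Q: "prob_space Q" unfolding Q_def by (rule N.prob_space_distr) simp
  interpret Q: prob_space Q by fact
  have sQ[measurable_cong]: "sets Q = sets (M1 \<Otimes>\<^sub>M M2)" by (simp add: Q_def)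
  have \<phi>Q[measurable]: "\<phi> \<in> measurable N Q" by (simp add: Q_def)
  have dQ: "distr N Q \<phi> = Q" unfolding Q_def by (rule distr_cong) auto
  have fs: "measure_preserving Q M1 fst" "measure_preserving Q M2 snd"
    using mp by (auto simp: measure_preserving_def Q_def distr_distr comp_def \<phi>_def)
  let ?V = "\<lambda>x y. pullback W1 fst x y - pullback W2 snd x y"
  have pp: "Q \<Otimes>\<^sub>M Q = distr (N \<Otimes>\<^sub>M N) (Q \<Otimes>\<^sub>M Q) (\<lambda>(x, y). (\<phi> x, \<phi> y))"
    using pair_measure_distr[OF \<phi>Q \<phi>Q] Q.sigma_finite_measure_axioms by (simp add: dQ)
  have [measurable]: "(\<lambda>p. W1 (fst p) (snd p)) \<in> borel_measurable (M1 \<Otimes>\<^sub>M M1)"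
    "(\<lambda>p. W2 (fst p) (snd p)) \<in> borel_measurable (M2 \<Otimes>\<^sub>M M2)"
    using k by (auto simp: kernel_on_def case_prod_beta')
  have bdd: "bdd_above ((\<lambda>(f, g). \<bar>LINT (x, y)|(N \<Otimes>\<^sub>M N). ?U x y * f x * g y\<bar>)
          ` (cut_test N \<times> cut_test N))"
    using N kernel_diff_bound[OF k mp] by (rule cut_norm_bdd)
  have "cut_norm Q ?V \<le> cut_norm N ?U"
    unfolding cut_norm_def[of Q]
  proof (rule cSUP_least)
    show "cut_test Q \<times> cut_test Q \<noteq> {}" using zero_in_cut_test by blast
  next
    fix p assume "p \<in> cut_test Q \<times> cut_test Q"
    then obtain f g where p: "p = (f, g)" and fg: "f \<in> cut_test Q" "g \<in> cut_test Q" by auto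
    have [measurable]: "f \<in> borel_measurable Q" "g \<in> borel_measurable Q"
      using fg by (auto simp: cut_test_def)
    have [measurable]: "(\<lambda>p. W1 (fst (fst p)) (fst (snd p))) \<in> borel_measurable (Q \<Otimes>\<^sub>M Q)"
    proof -
      have "(\<lambda>p. (fst (fst p), fst (snd p))) \<in> measurable (Q \<Otimes>\<^sub>M Q) (M1 \<Otimes>\<^sub>M M1)" by measurable
      from measurable_compose[OF this, of "\<lambda>p. W1 (fst p) (snd p)" borel] show ?thesis by simp
    qed
    have [measurable]: "(\<lambda>p. W2 (snd (fst p)) (snd (snd p))) \<in> borel_measurable (Q \<Otimes>\<^sub>M Q)"
    proof -
      have "(\<lambda>p. (snd (fst p), snd (snd p))) \<in> measurable (Q \<Otimes>\<^sub>M Q) (M2 \<Otimes>\<^sub>M M2)" by measurable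
      from measurable_compose[OF this, of "\<lambda>p. W2 (fst p) (snd p)" borel] show ?thesis by simp
    qed
    have F: "(\<lambda>(x, y). ?V x y * f x * g y) \<in> borel_measurable (Q \<Otimes>\<^sub>M Q)"
      unfolding pullback_def case_prod_beta' by measurable
    have "(LINT (x, y)|(Q \<Otimes>\<^sub>M Q). ?V x y * f x * g y)
        = (LINT (x, y)|(N \<Otimes>\<^sub>M N). ?U x y * f (\<phi> x) * g (\<phi> y))"
      by (subst pp, subst integral_distr[OF _ F])
        (auto simp: case_prod_beta' pullback_def \<phi>_def[abs_def])
    moreover have "f \<circ> \<phi> \<in> cut_test N" "g \<circ> \<phi> \<in> cut_test N"
      using fg measurable_space[OF \<phi>Q] by (auto simp: cut_test_def)
    then have "\<bar>LINT (x, y)|(N \<Otimes>\<^sub>M N). ?U x y * (f \<circ> \<phi>) x * (g \<circ> \<phi>) y\<bar> \<le> cut_norm N ?U"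
      unfolding cut_norm_def
      using cSUP_upper[OF _ bdd, of "(f \<circ> \<phi>, g \<circ> \<phi>)"] by simp
    ultimately show "(case p of (f, g) \<Rightarrow> \<bar>LINT (x, y)|(Q \<Otimes>\<^sub>M Q). ?V x y * f x * g y\<bar>) \<le> cut_norm N ?U"
      by (simp add: p)
  qed
  moreover have "cut_dist M1 W1 M2 W2 \<le> cut_norm Q ?V"
    unfolding cut_dist_def
    by (rule cINF_lower2[where x = "(Q, fst, snd)"])
      (use Q fs in \<open>auto intro!: bdd_belowI[of _ 0] cut_norm_nonneg kernel_diff_bound[OF k]\<close>)
  ultimately show ?thesis by linarith
qed

end

theory Submission
  imports Defs
begin

text \<open>
  Write \<open>W_A(x)\<close> for the integral of \<open>W(x, z)\<close> over \<open>z\<close> in \<open>A\<close> and \<open>d = W_S\<close> for the degree. Everything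
  is equivalent to the following order-free condition: for every \<open>A\<close>, almost everywhere
  \<open>(W_A(x) - W_A(y))\<^sub>+ \<le> (d(x) - d(y))\<^sub>+\<close>. It holds for a monotone kernel because \<open>W_A\<close> and \<open>d - W_A\<close>, the
  integral over the complement of \<open>A\<close>, increase together; it is stable under cut norm
  limits, hence passes to equivalent kernels; and it follows from \<open>\<Omega>(W) = 0\<close> by testing with \<open>A\<close> and
  its complement. Conversely, the condition makes the sections of \<open>W\<close> increase with the degree, so that
  almost everywhere \<open>W(x, y) = F(d(x), d(y))\<close>, where the monotone Borel function \<open>F(s, t)\<close> is the
  essential supremum of \<open>W\<close> over the points with degrees at most \<open>s\<close> and \<open>t\<close>. Ordering \<open>S\<close> by degree
  (ties broken by the given order) gives a monotone version on \<open>S\<close>, and composing \<open>F\<close> with the quantile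
  function of the degree distribution gives an equivalent monotone kernel on \<open>[0,1]\<close>.
\<close>

section \<open>Step function approximation on product spaces\<close>

text \<open>The sigma-algebra of \<open>S\<close> need not be countably generated and
  \<open>S\<close> need not be standard, which shapes two steps. The null set in the condition
  depends on \<open>A\<close>, so sections cannot be compared by running through one countable
  family of sets; and two couplings that share the space \<open>S\<close> need not glue over each of
  its points, since conditional distributions may fail to exist. In both places an L1-approximation
  by step functions with finitely many cells replaces the missing structure: only the cells of one
  partition matter at a time. Gluing is needed because the quantile function gives no map between
  \<open>S\<close> and [0,1]: both spaces map onto the degree law, so the equivalence has to pass
  through that law, and transitivity of cut distance zero is required without any regularity of the
  spaces. The quadrants over which the essential supremum is taken are closed (degree at most
  \<open>s\<close>) because the degree law may have atoms; an open quadrant would miss the value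
  attained at an atom.\<close>

text \<open>L1-density of finite combinations of rectangles. A finite measurable partition is
  encoded by a labelling with finitely many natural numbers, so that a common refinement is just a
  pairing of labels; \<open>T\<close> holds the value on each rectangle of cells.\<close>

definition step_approximable :: "'a measure \<Rightarrow> 'b measure \<Rightarrow> ('a \<times> 'b \<Rightarrow> real) \<Rightarrow> bool" where
  "step_approximable M N U \<longleftrightarrow> (\<forall>e>0. \<exists>(\<pi> :: 'a \<Rightarrow> nat) (\<rho> :: 'b \<Rightarrow> nat) T.
     \<pi> \<in> measurable M (count_space UNIV) \<and> finite (range \<pi>) \<and>
     \<rho> \<in> measurable N (count_space UNIV) \<and> finite (range \<rho>) \<and>
     (LINT p|(M \<Otimes>\<^sub>M N). \<bar>U p - T (\<pi> (fst p)) (\<rho> (snd p))\<bar>) < e)"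

lemma step_function_integrable:
  fixes \<pi> :: "'a \<Rightarrow> nat" and \<rho> :: "'b \<Rightarrow> nat" and T :: "nat \<Rightarrow> nat \<Rightarrow> real"
  assumes "prob_space M" "prob_space N"
    and [measurable]: "\<pi> \<in> measurable M (count_space UNIV)" "\<rho> \<in> measurable N (count_space UNIV)"
    and fin: "finite (range \<pi>)" "finite (range \<rho>)"
  shows "integrable (M \<Otimes>\<^sub>M N) (\<lambda>p. T (\<pi> (fst p)) (\<rho> (snd p)))"
proof -
  interpret M: prob_space M by fact
  interpret N: prob_space N by fact
  interpret P: pair_prob_space M N ..
  have "finite ((\<lambda>(i, j). \<bar>T i j\<bar>) ` (range \<pi> \<times> range \<rho>))" using fin by blast
  then obtain B where B: "\<forall>t\<in>(\<lambda>(i, j). \<bar>T i j\<bar>) ` (range \<pi> \<times> range \<rho>). t \<le> B"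
    using bdd_above_finite unfolding bdd_above_def by blast
  have [measurable]: "(\<lambda>p. T (\<pi> (fst p)) (\<rho> (snd p))) \<in> borel_measurable (M \<Otimes>\<^sub>M N)"
    by measurable
  show ?thesis
    by (rule P.integrable_const_bound[where B = B]) (use B in auto)
qed

lemma step_approximable_add:
  assumes pr: "prob_space M" "prob_space N"
    and i: "integrable (M \<Otimes>\<^sub>M N) U" "integrable (M \<Otimes>\<^sub>M N) V"
    and s: "step_approximable M N U" "step_approximable M N V"
  shows "step_approximable M N (\<lambda>p. U p + V p)"
  unfolding step_approximable_def
proof (intro allI impI)
  fix e :: real assume "e > 0"
  then have e2: "e / 2 > 0" by simp
  obtain \<pi>1 :: "'a \<Rightarrow> nat" and \<rho>1 :: "'b \<Rightarrow> nat" and T1 where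
    m1[measurable]: "\<pi>1 \<in> measurable M (count_space UNIV)" "\<rho>1 \<in> measurable N (count_space UNIV)"
    and f1: "finite (range \<pi>1)" "finite (range \<rho>1)"
    and l1: "(LINT p|(M \<Otimes>\<^sub>M N). \<bar>U p - T1 (\<pi>1 (fst p)) (\<rho>1 (snd p))\<bar>) < e / 2"
    using s(1) e2 unfolding step_approximable_def by meson
  obtain \<pi>2 :: "'a \<Rightarrow> nat" and \<rho>2 :: "'b \<Rightarrow> nat" and T2 where
    m2[measurable]: "\<pi>2 \<in> measurable M (count_space UNIV)" "\<rho>2 \<in> measurable N (count_space UNIV)"
    and f2: "finite (range \<pi>2)" "finite (range \<rho>2)"
    and l2: "(LINT p|(M \<Otimes>\<^sub>M N). \<bar>V p - T2 (\<pi>2 (fst p)) (\<rho>2 (snd p))\<bar>) < e / 2"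
    using s(2) e2 unfolding step_approximable_def by meson
  \<comment> \<open>Common refinement: the new label stores both old labels, and \<open>T\<close>
    decodes them to add the two step functions.\<close>
  define \<pi> where "\<pi> = (\<lambda>x. prod_encode (\<pi>1 x, \<pi>2 x))"
  define \<rho> where "\<rho> = (\<lambda>x. prod_encode (\<rho>1 x, \<rho>2 x))"
  define T where "T = (\<lambda>i j. T1 (fst (prod_decode i)) (fst (prod_decode j))
    + T2 (snd (prod_decode i)) (snd (prod_decode j)))"
  have "\<pi> \<in> measurable M (count_space UNIV)" "\<rho> \<in> measurable N (count_space UNIV)"
    unfolding \<pi>_def \<rho>_def by measurable
  moreover have "range \<pi> \<subseteq> prod_encode ` (range \<pi>1 \<times> range \<pi>2)"
    "range \<rho> \<subseteq> prod_encode ` (range \<rho>1 \<times> range \<rho>2)"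
    unfolding \<pi>_def \<rho>_def by auto
  then have "finite (range \<pi>)" "finite (range \<rho>)"
    using f1 f2 by (meson finite_SigmaI finite_imageI finite_subset)+
  moreover have "(LINT p|(M \<Otimes>\<^sub>M N). \<bar>U p + V p - T (\<pi> (fst p)) (\<rho> (snd p))\<bar>) < e"
  proof -
    have "(LINT p|(M \<Otimes>\<^sub>M N). \<bar>U p + V p - T (\<pi> (fst p)) (\<rho> (snd p))\<bar>)
       \<le> (LINT p|(M \<Otimes>\<^sub>M N). \<bar>U p - T1 (\<pi>1 (fst p)) (\<rho>1 (snd p))\<bar>
            + \<bar>V p - T2 (\<pi>2 (fst p)) (\<rho>2 (snd p))\<bar>)"
    proof (rule integral_mono)
      show "integrable (M \<Otimes>\<^sub>M N) (\<lambda>p. \<bar>U p + V p - T (\<pi> (fst p)) (\<rho> (snd p))\<bar>)"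
        using step_function_integrable[OF pr, of \<pi> \<rho> T] calculation i by auto
      show "integrable (M \<Otimes>\<^sub>M N) (\<lambda>p. \<bar>U p - T1 (\<pi>1 (fst p)) (\<rho>1 (snd p))\<bar>
            + \<bar>V p - T2 (\<pi>2 (fst p)) (\<rho>2 (snd p))\<bar>)"
        using step_function_integrable[OF pr m1 f1, of T1] step_function_integrable[OF pr m2 f2, of T2] i
        by auto
    qed (auto simp: T_def \<pi>_def \<rho>_def)
    also have "\<dots> < e"
      using l1 l2 step_function_integrable[OF pr m1 f1, of T1] step_function_integrable[OF pr m2 f2, of T2] i
      by (subst Bochner_Integration.integral_add) auto
    finally show ?thesis .
  qed
  ultimately show "\<exists>(\<pi> :: 'a \<Rightarrow> nat) (\<rho> :: 'b \<Rightarrow> nat) T.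
     \<pi> \<in> measurable M (count_space UNIV) \<and> finite (range \<pi>) \<and>
     \<rho> \<in> measurable N (count_space UNIV) \<and> finite (range \<rho>) \<and>
     (LINT p|(M \<Otimes>\<^sub>M N). \<bar>U p + V p - T (\<pi> (fst p)) (\<rho> (snd p))\<bar>) < e"
    by (intro exI[of _ \<pi>] exI[of _ \<rho>] exI[of _ T] conjI)
qed

lemma step_approximable_scale:
  assumes "step_approximable M N U"
  shows "step_approximable M N (\<lambda>p. c * U p)"
  unfolding step_approximable_def
proof (intro allI impI)
  fix e :: real assume "e > 0"
  \<comment> \<open>The summand 1 keeps the quotient meaningful when \<open>c\<close> is 0.\<close>
  then have "e / (\<bar>c\<bar> + 1) > 0" by simp
  then obtain \<pi> :: "'a \<Rightarrow> nat" and \<rho> :: "'b \<Rightarrow> nat" and T where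
    m: "\<pi> \<in> measurable M (count_space UNIV)" "\<rho> \<in> measurable N (count_space UNIV)"
    "finite (range \<pi>)" "finite (range \<rho>)"
    and l: "(LINT p|(M \<Otimes>\<^sub>M N). \<bar>U p - T (\<pi> (fst p)) (\<rho> (snd p))\<bar>) < e / (\<bar>c\<bar> + 1)"
    using assms unfolding step_approximable_def by meson
  have "(LINT p|(M \<Otimes>\<^sub>M N). \<bar>c * U p - c * T (\<pi> (fst p)) (\<rho> (snd p))\<bar>)
      = \<bar>c\<bar> * (LINT p|(M \<Otimes>\<^sub>M N). \<bar>U p - T (\<pi> (fst p)) (\<rho> (snd p))\<bar>)"
    by (simp flip: right_diff_distrib add: abs_mult)
  also have "\<dots> \<le> (\<bar>c\<bar> + 1) * (LINT p|(M \<Otimes>\<^sub>M N). \<bar>U p - T (\<pi> (fst p)) (\<rho> (snd p))\<bar>)"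
    by (intro mult_right_mono) auto
  also have "\<dots> < e"
    using l by (simp add: pos_less_divide_eq mult.commute)
  finally show "\<exists>(\<pi> :: 'a \<Rightarrow> nat) (\<rho> :: 'b \<Rightarrow> nat) T.
     \<pi> \<in> measurable M (count_space UNIV) \<and> finite (range \<pi>) \<and>
     \<rho> \<in> measurable N (count_space UNIV) \<and> finite (range \<rho>) \<and>
     (LINT p|(M \<Otimes>\<^sub>M N). \<bar>c * U p - T (\<pi> (fst p)) (\<rho> (snd p))\<bar>) < e"
    using m by (intro exI[of _ \<pi>] exI[of _ \<rho>] exI[of _ "\<lambda>i j. c * T i j"]) simp
qed

lemma step_approximable_limit:
  assumes pr: "prob_space M" "prob_space N"
    and i: "\<And>n. integrable (M \<Otimes>\<^sub>M N) (U n)" "integrable (M \<Otimes>\<^sub>M N) V"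
    and s: "\<And>n. step_approximable M N (U n)"
    and lim: "(\<lambda>n. LINT p|(M \<Otimes>\<^sub>M N). \<bar>V p - U n p\<bar>) \<longlonglongrightarrow> 0"
  shows "step_approximable M N V"
  unfolding step_approximable_def
proof (intro allI impI)
  fix e :: real assume "e > 0"
  then have e2: "e / 2 > 0" by simp
  have "eventually (\<lambda>n. (LINT p|(M \<Otimes>\<^sub>M N). \<bar>V p - U n p\<bar>) < e / 2) sequentially"
    using lim e2 by (rule order_tendstoD)
  then obtain n where n: "(LINT p|(M \<Otimes>\<^sub>M N). \<bar>V p - U n p\<bar>) < e / 2"
    using eventually_happens by force
  obtain \<pi> :: "'a \<Rightarrow> nat" and \<rho> :: "'b \<Rightarrow> nat" and T where
    m: "\<pi> \<in> measurable M (count_space UNIV)" "\<rho> \<in> measurable N (count_space UNIV)"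
    "finite (range \<pi>)" "finite (range \<rho>)"
    and l: "(LINT p|(M \<Otimes>\<^sub>M N). \<bar>U n p - T (\<pi> (fst p)) (\<rho> (snd p))\<bar>) < e / 2"
    using s[of n] e2 unfolding step_approximable_def by meson
  note T = step_function_integrable[OF pr m, of T]
  have "(LINT p|(M \<Otimes>\<^sub>M N). \<bar>V p - T (\<pi> (fst p)) (\<rho> (snd p))\<bar>)
     \<le> (LINT p|(M \<Otimes>\<^sub>M N). \<bar>V p - U n p\<bar> + \<bar>U n p - T (\<pi> (fst p)) (\<rho> (snd p))\<bar>)"
    using T i by (intro integral_mono) auto
  also have "\<dots> < e"
    using T i n l by (subst Bochner_Integration.integral_add) auto
  finally show "\<exists>(\<pi> :: 'a \<Rightarrow> nat) (\<rho> :: 'b \<Rightarrow> nat) T.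
     \<pi> \<in> measurable M (count_space UNIV) \<and> finite (range \<pi>) \<and>
     \<rho> \<in> measurable N (count_space UNIV) \<and> finite (range \<rho>) \<and>
     (LINT p|(M \<Otimes>\<^sub>M N). \<bar>V p - T (\<pi> (fst p)) (\<rho> (snd p))\<bar>) < e"
    using m by (intro exI[of _ \<pi>] exI[of _ \<rho>] exI[of _ T] conjI)
qed

lemma step_approximable_rectangle:
  assumes [measurable]: "A \<in> sets M" "B \<in> sets N"
  shows "step_approximable M N (indicator (A \<times> B))"
proof -
  have "(\<lambda>x. indicator A x :: nat) \<in> measurable M (count_space UNIV)"
    "(\<lambda>x. indicator B x :: nat) \<in> measurable N (count_space UNIV)"
    unfolding indicator_def of_bool_def by measurable
  moreover have "finite (range (\<lambda>x. indicator A x :: nat))" "finite (range (\<lambda>x. indicator B x :: nat))"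
    by (rule finite_subset[of _ "{0, 1}"], auto simp: indicator_def)+
  moreover have "(LINT p|(M \<Otimes>\<^sub>M N). \<bar>indicator (A \<times> B) p
      - (\<lambda>i j. real (i * j)) (indicator A (fst p)) (indicator B (snd p))\<bar>) = 0"
    by (rule integral_eq_zero_AE) (auto simp: indicator_def)
  ultimately show ?thesis
    unfolding step_approximable_def
    by (intro allI impI exI[of _ "\<lambda>x. indicator A x"] exI[of _ "\<lambda>x. indicator B x"]
        exI[of _ "\<lambda>i j. real (i * j)"] conjI) (simp_all only:)
qed

text \<open>A Dynkin argument: rectangles form an intersection-stable generator, and approximability
  passes to complements by linearity and to disjoint countable unions by L1-limits.\<close>

lemma step_approximable_indicator:
  assumes pr: "prob_space M" "prob_space N" and G: "G \<in> sets (M \<Otimes>\<^sub>M N)"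
  shows "step_approximable M N (indicator G)"
proof -
  interpret M: prob_space M by fact
  interpret N: prob_space N by fact
  interpret P: pair_prob_space M N ..
  let ?R = "{A \<times> B | A B. A \<in> sets M \<and> B \<in> sets N}"
  have I: "integrable (M \<Otimes>\<^sub>M N) (indicator H :: _ \<Rightarrow> real)" if "H \<in> sets (M \<Otimes>\<^sub>M N)" for H
    using that by (rule integrable_real_indicator) (simp add: P.emeasure_finite less_top[symmetric])
  have st: "sigma_sets (space M \<times> space N) ?R = sets (M \<Otimes>\<^sub>M N)"
    by (simp add: sets_pair_measure)
  have "Int_stable ?R" by (rule Int_stable_pair_measure_generator)
  moreover have "?R \<subseteq> Pow (space M \<times> space N)"
    by (auto dest: sets.sets_into_space)
  moreover have "G \<in> sigma_sets (space M \<times> space N) ?R" using G st by simp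
  ultimately show ?thesis
  proof (induction rule: sigma_sets_induct_disjoint)
    case (basic A)
    then show ?case by (auto intro: step_approximable_rectangle)
  next
    case empty
    show ?case using step_approximable_rectangle[of "{}" M "{}" N] by (simp add: indicator_def[abs_def])
  next
    case (compl A)
    have A: "A \<in> sets (M \<Otimes>\<^sub>M N)" using compl(1) st by simp
    have "step_approximable M N (\<lambda>p. indicator (space M \<times> space N) p + (-1) * indicator A p)"
      using A by (intro step_approximable_add pr step_approximable_scale compl
        step_approximable_rectangle I integrable_mult_right) (auto intro!: I)
    moreover have "A \<subseteq> space M \<times> space N"
      using sets.sets_into_space[OF A] by (simp add: space_pair_measure)
    then have "(\<lambda>p. indicator (space M \<times> space N) p + (-1) * indicator A p)
        = (indicator (space M \<times> space N - A) :: _ \<Rightarrow> real)"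
      by (intro ext) (auto simp: indicator_def)
    ultimately show ?case by simp
  next
    case (union A)
    have A[measurable]: "A i \<in> sets (M \<Otimes>\<^sub>M N)" for i
      using union(2) st by auto
    have s: "step_approximable M N (\<lambda>p. \<Sum>i<n. indicator (A i) p)" for n
    proof (induction n)
      case 0
      show ?case using step_approximable_rectangle[of "{}" M "{}" N] by (simp add: indicator_def[abs_def])
    next
      case (Suc n)
      then show ?case
        using step_approximable_add[OF pr _ _ Suc union(3)[of n]] by (simp add: I A)
    qed
    have "(\<lambda>n. LINT p|(M \<Otimes>\<^sub>M N). \<bar>indicator (\<Union>(range A)) p - (\<Sum>i<n. indicator (A i) p)\<bar>)
        \<longlonglongrightarrow> (LINT p|(M \<Otimes>\<^sub>M N). 0 :: real)"
    \<comment> \<open>Partial sums of disjoint indicators are indicators of partial unions, so each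
      difference is at most 1; the constant 2 is merely a convenient bound.\<close>
    proof (rule integral_dominated_convergence[where w = "\<lambda>_. 2"])
      show "AE p in M \<Otimes>\<^sub>M N. (\<lambda>n. \<bar>indicator (\<Union>(range A)) p - (\<Sum>i<n. indicator (A i) p)\<bar>)
          \<longlonglongrightarrow> (0 :: real)"
      proof (rule AE_I2)
        fix p
        have "(\<lambda>i. indicator (A i) p) sums (indicator (\<Union>(range A)) p :: real)"
        proof (cases "p \<in> \<Union>(range A)")
          case True
          then obtain i where i: "p \<in> A i" by auto
          have "indicator (A j) p = (if j = i then 1 else 0 :: real)" for j
            using union(1) i by (auto simp: disjoint_family_on_def indicator_def)
          then show ?thesis using True sums_single[of i "\<lambda>_. 1 :: real"] by simp
        next
          case False
          then show ?thesis by (auto simp: indicator_def)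
        qed
        then have "(\<lambda>n. (\<Sum>i<n. indicator (A i) p)) \<longlonglongrightarrow> (indicator (\<Union>(range A)) p :: real)"
          by (simp add: sums_def)
        from tendsto_rabs[OF tendsto_diff[OF tendsto_const this], of "indicator (\<Union>(range A)) p"]
        show "(\<lambda>n. \<bar>indicator (\<Union>(range A)) p - (\<Sum>i<n. indicator (A i) p)\<bar>) \<longlonglongrightarrow> (0 :: real)"
          by simp
      qed
      fix n
      show "AE p in M \<Otimes>\<^sub>M N. norm \<bar>indicat_real (\<Union>(range A)) p - (\<Sum>i<n. indicator (A i) p)\<bar> \<le> (2 :: real)"
      proof (rule AE_I2)
        fix p
        have "(\<Sum>i<n. indicator (A i) p) = (indicator (\<Union>i<n. A i) p :: real)"
          using union(1) by (subst indicator_UN_disjoint) (auto simp: disjoint_family_on_def)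
        then show "norm \<bar>indicat_real (\<Union>(range A)) p - (\<Sum>i<n. indicator (A i) p)\<bar> \<le> (2 :: real)"
          by (simp only:) (simp split: split_indicator)
      qed
    qed auto
    then show ?case
      by (intro step_approximable_limit[OF pr _ _ s]) (auto intro!: I)
  qed
qed

lemma step_approximable_integrable:
  assumes pr: "prob_space M" "prob_space N" and U: "integrable (M \<Otimes>\<^sub>M N) U"
  shows "step_approximable M N U"
  using U
proof (induction rule: integrable_induct)
  case (base A c)
  then show ?case
    using step_approximable_scale[OF step_approximable_indicator[OF pr], of A c]
    by (simp add: mult.commute)
next
  case (add f g)
  then show ?case by (intro step_approximable_add pr)
next
  case (lim f s)
  have "(\<lambda>n. LINT p|(M \<Otimes>\<^sub>M N). \<bar>f p - s n p\<bar>) \<longlonglongrightarrow> (LINT p|(M \<Otimes>\<^sub>M N). 0)"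
  \<comment> \<open>The approximating simple functions satisfy
    \<open>norm (s n p) \<le> 2 * norm (f p)\<close>, hence the factor 3 for the difference.\<close>
  proof (rule integral_dominated_convergence[where w = "\<lambda>p. 3 * \<bar>f p\<bar>"])
    show "AE p in M \<Otimes>\<^sub>M N. (\<lambda>n. \<bar>f p - s n p\<bar>) \<longlonglongrightarrow> 0"
    proof (rule AE_I2)
      fix p assume "p \<in> space (M \<Otimes>\<^sub>M N)"
      from tendsto_rabs[OF tendsto_diff[OF tendsto_const lim(2)[OF this]], of "f p"]
      show "(\<lambda>n. \<bar>f p - s n p\<bar>) \<longlonglongrightarrow> 0" by simp
    qed
    show "AE p in M \<Otimes>\<^sub>M N. norm \<bar>f p - s n p\<bar> \<le> 3 * \<bar>f p\<bar>" for n
    proof (rule AE_I2)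
      fix p assume "p \<in> space (M \<Otimes>\<^sub>M N)"
      from lim(3)[OF this, of n] show "norm \<bar>f p - s n p\<bar> \<le> 3 * \<bar>f p\<bar>" by simp
    qed
  qed (use lim in auto)
  then show ?case
    using lim by (intro step_approximable_limit[OF pr, of s f]) simp_all
qed

section \<open>The cut norm\<close>

lemma cut_norm_upper:
  assumes "prob_space N" "\<And>x y. x \<in> space N \<Longrightarrow> y \<in> space N \<Longrightarrow> \<bar>U x y\<bar> \<le> B"
    and "f \<in> cut_test N" "g \<in> cut_test N"
  shows "\<bar>LINT p|(N \<Otimes>\<^sub>M N). U (fst p) (snd p) * f (fst p) * g (snd p)\<bar> \<le> cut_norm N U"
  unfolding cut_norm_def using assms(3,4)
  by (intro cSUP_upper2[where x = "(f, g)"] cut_norm_bdd[OF assms(1,2)]) (auto simp: case_prod_beta')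

lemma cut_norm_least:
  assumes "\<And>f g. f \<in> cut_test N \<Longrightarrow> g \<in> cut_test N \<Longrightarrow>
    \<bar>LINT p|(N \<Otimes>\<^sub>M N). U (fst p) (snd p) * f (fst p) * g (snd p)\<bar> \<le> c"
  shows "cut_norm N U \<le> c"
  unfolding cut_norm_def using zero_in_cut_test[of N] assms
  by (intro cSUP_least) (auto simp: case_prod_beta')

lemma cut_test_abs_le_1: "f \<in> cut_test N \<Longrightarrow> x \<in> space N \<Longrightarrow> \<bar>f x\<bar> \<le> 1"
  by (auto simp: cut_test_def abs_le_iff)

lemma cut_test_measurable: "f \<in> cut_test N \<Longrightarrow> f \<in> borel_measurable N"
  by (simp add: cut_test_def)

lemma cut_integrand_bound:
  assumes "f \<in> cut_test N" "g \<in> cut_test N" "x \<in> space N" "y \<in> space N"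
  shows "\<bar>u * f x * g y\<bar> \<le> \<bar>u\<bar>"
proof -
  have "\<bar>u\<bar> * \<bar>f x\<bar> * \<bar>g y\<bar> \<le> \<bar>u\<bar> * 1 * 1"
    using assms by (intro mult_mono cut_test_abs_le_1) auto
  then show ?thesis by (simp add: abs_mult)
qed

lemma integrable_pair_bounded:
  assumes "prob_space M" "prob_space N" "U \<in> borel_measurable (M \<Otimes>\<^sub>M N)"
    and "\<And>x y. x \<in> space M \<Longrightarrow> y \<in> space N \<Longrightarrow> \<bar>U (x, y)\<bar> \<le> B"
  shows "integrable (M \<Otimes>\<^sub>M N) (U :: _ \<Rightarrow> real)"
proof -
  interpret M: prob_space M by fact
  interpret N: prob_space N by fact
  interpret P: pair_prob_space M N ..
  show ?thesis
    using assms(3,4)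
    by (intro P.integrable_const_bound[where B = B] AE_I2) (auto simp: space_pair_measure)
qed

lemma integrable_cut_integrand:
  assumes N: "prob_space N" and [measurable]: "(\<lambda>p. U (fst p) (snd p)) \<in> borel_measurable (N \<Otimes>\<^sub>M N)"
    and B: "\<And>x y. x \<in> space N \<Longrightarrow> y \<in> space N \<Longrightarrow> \<bar>U x y\<bar> \<le> B"
    and fg: "f \<in> cut_test N" "g \<in> cut_test N"
  shows "integrable (N \<Otimes>\<^sub>M N) (\<lambda>p. U (fst p) (snd p) * f (fst p) * g (snd p))"
proof -
  have [measurable]: "f \<in> borel_measurable N" "g \<in> borel_measurable N"
    using fg by (auto intro: cut_test_measurable)
  show ?thesis
  proof (rule integrable_pair_bounded[OF N N, where B = B])
    fix x y assume "x \<in> space N" "y \<in> space N"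
    then show "\<bar>U (fst (x, y)) (snd (x, y)) * f (fst (x, y)) * g (snd (x, y))\<bar> \<le> B"
      using cut_integrand_bound[OF fg, of x y "U x y"] B[of x y] by simp
  qed measurable
qed

lemma cut_norm_triangle:
  assumes N: "prob_space N"
    and m: "(\<lambda>p. U (fst p) (snd p)) \<in> borel_measurable (N \<Otimes>\<^sub>M N)"
      "(\<lambda>p. V (fst p) (snd p)) \<in> borel_measurable (N \<Otimes>\<^sub>M N)"
    and B: "\<And>x y. x \<in> space N \<Longrightarrow> y \<in> space N \<Longrightarrow> \<bar>U x y\<bar> \<le> B"
      "\<And>x y. x \<in> space N \<Longrightarrow> y \<in> space N \<Longrightarrow> \<bar>V x y\<bar> \<le> C"
  shows "cut_norm N (\<lambda>x y. U x y + V x y) \<le> cut_norm N U + cut_norm N V"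
proof (rule cut_norm_least)
  fix f g assume fg: "f \<in> cut_test N" "g \<in> cut_test N"
  have "(LINT p|(N \<Otimes>\<^sub>M N). (U (fst p) (snd p) + V (fst p) (snd p)) * f (fst p) * g (snd p))
    = (LINT p|(N \<Otimes>\<^sub>M N). U (fst p) (snd p) * f (fst p) * g (snd p))
    + (LINT p|(N \<Otimes>\<^sub>M N). V (fst p) (snd p) * f (fst p) * g (snd p))"
    using integrable_cut_integrand[OF N m(1) B(1) fg] integrable_cut_integrand[OF N m(2) B(2) fg]
    by (simp add: distrib_right)
  then show "\<bar>LINT p|(N \<Otimes>\<^sub>M N). (U (fst p) (snd p) + V (fst p) (snd p)) * f (fst p) * g (snd p)\<bar>
     \<le> cut_norm N U + cut_norm N V"
    using cut_norm_upper[of N U, OF N B(1) fg] cut_norm_upper[of N V, OF N B(2) fg] by linarith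
qed

lemma cut_norm_le_L1:
  assumes N: "prob_space N" and m: "(\<lambda>p. U (fst p) (snd p)) \<in> borel_measurable (N \<Otimes>\<^sub>M N)"
    and B: "\<And>x y. x \<in> space N \<Longrightarrow> y \<in> space N \<Longrightarrow> \<bar>U x y\<bar> \<le> B"
  shows "cut_norm N U \<le> (LINT p|(N \<Otimes>\<^sub>M N). \<bar>U (fst p) (snd p)\<bar>)"
proof (rule cut_norm_least)
  fix f g assume fg: "f \<in> cut_test N" "g \<in> cut_test N"
  have "\<bar>LINT p|(N \<Otimes>\<^sub>M N). U (fst p) (snd p) * f (fst p) * g (snd p)\<bar>
    \<le> (LINT p|(N \<Otimes>\<^sub>M N). \<bar>U (fst p) (snd p) * f (fst p) * g (snd p)\<bar>)"
    by (rule integral_abs_bound)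
  also have "\<dots> \<le> (LINT p|(N \<Otimes>\<^sub>M N). \<bar>U (fst p) (snd p)\<bar>)"
    using integrable_cut_integrand[OF N m B fg] integrable_pair_bounded[OF N N m, of B] B
    by (intro integral_mono) (auto simp: space_pair_measure intro!: cut_integrand_bound[OF fg])
  finally show "\<bar>LINT p|(N \<Otimes>\<^sub>M N). U (fst p) (snd p) * f (fst p) * g (snd p)\<bar>
    \<le> (LINT p|(N \<Otimes>\<^sub>M N). \<bar>U (fst p) (snd p)\<bar>)" .
qed

text \<open>Taking the first test function to be the sign of the inner integral turns the double
  integral into an L1 norm. With \<open>g\<close> the indicator of a set, closeness in cut norm
  becomes L1-closeness of the functions \<open>mass A\<close>.\<close>

lemma cut_norm_section:
  assumes N: "prob_space N" and [measurable]: "(\<lambda>p. U (fst p) (snd p)) \<in> borel_measurable (N \<Otimes>\<^sub>M N)"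
    and B: "\<And>x y. x \<in> space N \<Longrightarrow> y \<in> space N \<Longrightarrow> \<bar>U x y\<bar> \<le> B"
    and g: "g \<in> cut_test N"
  shows "(LINT x|N. \<bar>LINT y|N. U x y * g y\<bar>) \<le> cut_norm N U"
proof -
  interpret prob_space N by fact
  interpret P: pair_prob_space N N ..
  have [measurable]: "g \<in> borel_measurable N" using g by (rule cut_test_measurable)
  define h where "h = (\<lambda>x. LINT y|N. U x y * g y)"
  have [measurable]: "h \<in> borel_measurable N" unfolding h_def by measurable
  define f where "f = (\<lambda>x. sgn (h x))"
  have f: "f \<in> cut_test N" unfolding cut_test_def f_def by (auto simp: sgn_if)
  have "(LINT x|N. \<bar>h x\<bar>) = (LINT x|N. LINT y|N. U x y * f x * g y)"
  proof (rule Bochner_Integration.integral_cong[OF refl])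
    fix x
    have "(LINT y|N. U x y * f x * g y) = (LINT y|N. f x * (U x y * g y))"
      by (intro Bochner_Integration.integral_cong) auto
    then show "\<bar>h x\<bar> = (LINT y|N. U x y * f x * g y)"
      by (simp add: h_def f_def abs_sgn mult.commute)
  qed
  also have "\<dots> = (LINT p|(N \<Otimes>\<^sub>M N). U (fst p) (snd p) * f (fst p) * g (snd p))"
    using P.integral_fst'[OF integrable_cut_integrand[OF N assms(2) B f g]] by simp
  also have "\<dots> \<le> cut_norm N U"
    using cut_norm_upper[of N U, OF N B f g] by linarith
  finally show ?thesis by (simp add: h_def)
qed

lemma measure_preserving_integral:
  assumes "measure_preserving Q M \<phi>" "f \<in> borel_measurable M"
  shows "(LINT q|Q. f (\<phi> q)) = (LINT x|M. (f x :: real))"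
  using integral_distr[of \<phi> Q M f] assms by (simp add: measure_preserving_def)

text \<open>Averaging a test function over the fibres of \<open>\<phi>\<close>, that is, conditioning it on \<open>\<phi>\<close>.\<close>

lemma cut_test_conditional:
  assumes Q: "prob_space Q" and N: "prob_space N" and mp: "measure_preserving Q N \<phi>"
    and f: "f \<in> cut_test Q"
  shows "\<exists>f'\<in>cut_test N. \<forall>k\<in>borel_measurable N. \<forall>B. (\<forall>x\<in>space N. \<bar>k x\<bar> \<le> B) \<longrightarrow>
    (LINT q|Q. k (\<phi> q) * f q) = (LINT x|N. k x * f' x)"
proof -
  interpret Q: prob_space Q by fact
  interpret N: prob_space N by fact
  have [measurable]: "\<phi> \<in> measurable Q N" and dN: "distr Q N \<phi> = N"
    using mp by (auto simp: measure_preserving_def)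
  have [measurable]: "f \<in> borel_measurable Q" using f by (rule cut_test_measurable)
  \<comment> \<open>Shifting \<open>f\<close> from [-1,1] to [0,1] makes it a density, so the
    conditional version is a Radon-Nikodym derivative of the image measure;
    \<open>f' = 2 * c - 1\<close> undoes the shift.\<close>
  define w where "w = (\<lambda>q. (f q + 1) / 2)"
  have [measurable]: "w \<in> borel_measurable Q" unfolding w_def by measurable
  have w: "0 \<le> w q \<and> w q \<le> 1" if "q \<in> space Q" for q
    using cut_test_abs_le_1[OF f that] by (auto simp: w_def)
  define \<nu> where "\<nu> = distr (density Q (\<lambda>q. ennreal (w q))) N \<phi>"
  have \<nu>_le: "emeasure \<nu> A \<le> emeasure N A" if [measurable]: "A \<in> sets N" for A
  proof -
    have "emeasure \<nu> A = (\<integral>\<^sup>+q. ennreal (w q) * indicator (\<phi> -` A \<inter> space Q) q \<partial>Q)"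
      unfolding \<nu>_def by (simp add: emeasure_distr emeasure_density)
    also have "\<dots> \<le> (\<integral>\<^sup>+q. indicator (\<phi> -` A \<inter> space Q) q \<partial>Q)"
      using w by (intro nn_integral_mono) (auto simp: indicator_def)
    also have "\<dots> = emeasure (distr Q N \<phi>) A"
      by (simp add: emeasure_distr)
    finally show ?thesis by (simp add: dN)
  qed
  have "absolutely_continuous N \<nu>"
    unfolding absolutely_continuous_def
    using \<nu>_le by (force simp: null_sets_def \<nu>_def[THEN arg_cong[of _ _ sets]])
  then obtain h where hm[measurable]: "h \<in> borel_measurable N" and h: "density N h = \<nu>"
    using N.Radon_Nikodym[of \<nu>] by (auto simp: \<nu>_def)
  have "AE x in N. h x \<le> 1"
  proof -
    let ?G = "{x\<in>space N. 1 < h x}"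
    have mG: "?G \<in> sets N" by measurable
    have le: "(\<integral>\<^sup>+x. h x * indicator ?G x \<partial>N) \<le> (\<integral>\<^sup>+x. indicator ?G x \<partial>N)"
      using \<nu>_le[of ?G] by (simp add: h[symmetric] emeasure_density)
    have "AE x in N. h x * indicator ?G x \<le> indicator ?G x"
    proof (rule ccontr)
      assume "\<not> (AE x in N. h x * indicator ?G x \<le> indicator ?G x)"
      then have "(\<integral>\<^sup>+x. indicator ?G x \<partial>N) < (\<integral>\<^sup>+x. h x * indicator ?G x \<partial>N)"
        by (intro nn_integral_less) (auto split: split_indicator simp: N.emeasure_finite)
      then show False using le by simp
    qed
    then show ?thesis
      using AE_space by eventually_elim (auto split: split_indicator_asm intro: leI)
  qed
  \<comment> \<open>The derivative is at most 1 only almost everywhere, whereas membership in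
    \<open>cut_test\<close> asks for a bound at every point; truncation supplies it.\<close>
  define c where "c = (\<lambda>x. min 1 (enn2real (h x)))"
  have c[measurable]: "c \<in> borel_measurable N" unfolding c_def by measurable
  have c01: "0 \<le> c x \<and> c x \<le> 1" for x by (simp add: c_def)
  have "AE x in N. h x = ennreal (c x)"
    using \<open>AE x in N. h x \<le> 1\<close>
  proof eventually_elim
    case (elim x)
    then show ?case
      by (cases "h x") (auto simp: c_def min_def top_unique)
  qed
  then have "density N h = density N (\<lambda>x. ennreal (c x))"
    by (intro density_cong) auto
  with h have \<nu>c: "\<nu> = density N (\<lambda>x. ennreal (c x))" by simp
  define f' where "f' = (\<lambda>x. 2 * c x - 1)"
  have "f' \<in> cut_test N"
    using c01 by (auto simp: cut_test_def f'_def)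
  moreover have "(LINT q|Q. k (\<phi> q) * f q) = (LINT x|N. k x * f' x)"
    if [measurable]: "k \<in> borel_measurable N" and B: "\<forall>x\<in>space N. \<bar>k x\<bar> \<le> B" for k B
  proof -
    have "(LINT q|Q. w q * k (\<phi> q)) = (LINT q|density Q (\<lambda>q. ennreal (w q)). k (\<phi> q))"
      using w by (subst integral_density) auto
    also have "\<dots> = (LINT x|\<nu>. k x)"
      unfolding \<nu>_def by (subst integral_distr) auto
    also have "\<dots> = (LINT x|N. c x * k x)"
      unfolding \<nu>c using c01 by (subst integral_density) auto
    finally have 1: "(LINT q|Q. w q * k (\<phi> q)) = (LINT x|N. c x * k x)" .
    have 2: "(LINT q|Q. k (\<phi> q)) = (LINT x|N. k x)"
      by (rule measure_preserving_integral[OF mp]) simp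
    have kB: "\<bar>k (\<phi> q)\<bar> \<le> B" if "q \<in> space Q" for q
      using B measurable_space[OF \<open>\<phi> \<in> measurable Q N\<close> that] by auto
    have iQ: "integrable Q (\<lambda>q. k (\<phi> q))"
      using kB by (intro Q.integrable_const_bound[where B = B] AE_I2) auto
    have iQw: "integrable Q (\<lambda>q. w q * k (\<phi> q))"
    proof (intro Q.integrable_const_bound[where B = B] AE_I2)
      fix q assume q: "q \<in> space Q"
      have "\<bar>w q\<bar> * \<bar>k (\<phi> q)\<bar> \<le> 1 * B" using kB[OF q] w[OF q] by (intro mult_mono) auto
      then show "norm (w q * k (\<phi> q)) \<le> B" by (simp add: abs_mult)
    qed measurable
    have iN: "integrable N k"
      using B by (intro N.integrable_const_bound[where B = B] AE_I2) auto
    have iNc: "integrable N (\<lambda>x. c x * k x)"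
    proof (intro N.integrable_const_bound[where B = B] AE_I2)
      fix x assume x: "x \<in> space N"
      have "\<bar>c x\<bar> * \<bar>k x\<bar> \<le> 1 * B" using B x c01[of x] by (intro mult_mono) auto
      then show "norm (c x * k x) \<le> B" by (simp add: abs_mult)
    qed measurable
    have "(LINT q|Q. k (\<phi> q) * f q) = (LINT q|Q. 2 * (w q * k (\<phi> q)) - k (\<phi> q))"
      by (intro Bochner_Integration.integral_cong) (auto simp: w_def field_simps)
    also have "\<dots> = 2 * (LINT q|Q. w q * k (\<phi> q)) - (LINT q|Q. k (\<phi> q))"
      using iQ iQw by simp
    also have "\<dots> = 2 * (LINT x|N. c x * k x) - (LINT x|N. k x)" by (simp add: 1 2)
    also have "\<dots> = (LINT x|N. 2 * (c x * k x) - k x)" using iN iNc by simp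
    also have "\<dots> = (LINT x|N. k x * f' x)"
      by (intro Bochner_Integration.integral_cong) (auto simp: f'_def field_simps)
    finally show ?thesis .
  qed
  ultimately show ?thesis by blast
qed

text \<open>By Fubini the two test functions on \<open>Q\<close> can be replaced, one variable at a
  time, by their conditional versions on \<open>N\<close> without changing the integral. This allows
  cut norm estimates on two couplings to be carried to a larger space on which both live.\<close>

lemma cut_norm_pullback_le:
  assumes Q: "prob_space Q" and N: "prob_space N" and mp: "measure_preserving Q N \<phi>"
    and [measurable]: "(\<lambda>p. U (fst p) (snd p)) \<in> borel_measurable (N \<Otimes>\<^sub>M N)"
    and B: "\<And>x y. x \<in> space N \<Longrightarrow> y \<in> space N \<Longrightarrow> \<bar>U x y\<bar> \<le> B"
  shows "cut_norm Q (pullback U \<phi>) \<le> cut_norm N U"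
proof (rule cut_norm_least)
  fix f g assume fg: "f \<in> cut_test Q" "g \<in> cut_test Q"
  interpret Q: prob_space Q by fact
  interpret N: prob_space N by fact
  interpret QQ: pair_prob_space Q Q ..
  interpret NN: pair_prob_space N N ..
  have \<phi>[measurable]: "\<phi> \<in> measurable Q N" using mp by (simp add: measure_preserving_def)
  obtain f' where f': "f' \<in> cut_test N" and f'_int: "\<And>k C. k \<in> borel_measurable N \<Longrightarrow>
      (\<And>x. x \<in> space N \<Longrightarrow> \<bar>k x\<bar> \<le> C) \<Longrightarrow> (LINT q|Q. k (\<phi> q) * f q) = (LINT x|N. k x * f' x)"
    using cut_test_conditional[OF Q N mp fg(1)] by metis
  obtain g' where g': "g' \<in> cut_test N" and g'_int: "\<And>k C. k \<in> borel_measurable N \<Longrightarrow>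
      (\<And>x. x \<in> space N \<Longrightarrow> \<bar>k x\<bar> \<le> C) \<Longrightarrow> (LINT q|Q. k (\<phi> q) * g q) = (LINT x|N. k x * g' x)"
    using cut_test_conditional[OF Q N mp fg(2)] by metis
  have [measurable]: "g' \<in> borel_measurable N" using g' by (rule cut_test_measurable)
  have mPQ: "(\<lambda>p. pullback U \<phi> (fst p) (snd p)) \<in> borel_measurable (Q \<Otimes>\<^sub>M Q)"
    using measurable_compose[OF _ assms(4), of "\<lambda>p. (\<phi> (fst p), \<phi> (snd p))" "Q \<Otimes>\<^sub>M Q"]
    by (simp add: pullback_def)
  have BPQ: "\<bar>pullback U \<phi> x y\<bar> \<le> B" if "x \<in> space Q" "y \<in> space Q" for x y
    using that B measurable_space[OF \<phi>] by (simp add: pullback_def)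
  have sec: "(LINT y|Q. U x (\<phi> y) * g y) = (LINT y|N. U x y * g' y)" if x: "x \<in> space N" for x
  proof (rule g'_int[of "U x" B])
    show "U x \<in> borel_measurable N"
      using measurable_compose[OF measurable_Pair1'[OF x] assms(4)] by simp
  qed (use B x in auto)
  define k where "k = (\<lambda>x. LINT y|N. U x y * g' y)"
  have [measurable]: "k \<in> borel_measurable N" unfolding k_def by measurable
  have kB: "\<bar>k x\<bar> \<le> B" if x: "x \<in> space N" for x
  proof -
    have *: "\<bar>U x y * g' y\<bar> \<le> B" if "y \<in> space N" for y
      using cut_integrand_bound[of "\<lambda>_. 1" N g' x y "U x y"] g' x that B[OF x that]
      by (auto simp: cut_test_def)
    have [measurable]: "U x \<in> borel_measurable N"
      using measurable_compose[OF measurable_Pair1'[OF x] assms(4)] by simp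
    have i: "integrable N (\<lambda>y. U x y * g' y)"
      using * by (intro N.integrable_const_bound[where B = B] AE_I2) auto
    have "\<bar>k x\<bar> \<le> (LINT y|N. \<bar>U x y * g' y\<bar>)" unfolding k_def by (rule integral_abs_bound)
    also have "\<dots> \<le> (LINT y|N. B)" using * i by (intro integral_mono) auto
    finally show ?thesis by (simp add: N.prob_space)
  qed
  have "(LINT p|(Q \<Otimes>\<^sub>M Q). pullback U \<phi> (fst p) (snd p) * f (fst p) * g (snd p))
      = (LINT x|Q. LINT y|Q. pullback U \<phi> x y * f x * g y)"
    using QQ.integral_fst'[OF integrable_cut_integrand[OF Q mPQ BPQ fg]] by simp
  also have "\<dots> = (LINT x|Q. k (\<phi> x) * f x)"
  proof (rule Bochner_Integration.integral_cong[OF refl])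
    fix x assume "x \<in> space Q"
    then have x: "\<phi> x \<in> space N" using measurable_space[OF \<phi>] by simp
    have "(LINT y|Q. pullback U \<phi> x y * f x * g y) = (LINT y|Q. (U (\<phi> x) (\<phi> y) * g y) * f x)"
      by (intro Bochner_Integration.integral_cong) (auto simp: pullback_def)
    also have "\<dots> = k (\<phi> x) * f x" by (simp add: sec[OF x] k_def)
    finally show "(LINT y|Q. pullback U \<phi> x y * f x * g y) = k (\<phi> x) * f x" .
  qed
  also have "\<dots> = (LINT x|N. k x * f' x)"
    by (rule f'_int[of k B]) (auto simp: kB)
  also have "\<dots> = (LINT x|N. LINT y|N. U x y * f' x * g' y)"
  proof (rule Bochner_Integration.integral_cong[OF refl])
    fix x
    have "(LINT y|N. U x y * f' x * g' y) = (LINT y|N. (U x y * g' y) * f' x)"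
      by (intro Bochner_Integration.integral_cong) auto
    then show "k x * f' x = (LINT y|N. U x y * f' x * g' y)" by (simp add: k_def)
  qed
  also have "\<dots> = (LINT p|(N \<Otimes>\<^sub>M N). U (fst p) (snd p) * f' (fst p) * g' (snd p))"
    using NN.integral_fst'[OF integrable_cut_integrand[OF N assms(4) B f' g']] by simp
  finally show "\<bar>LINT p|(Q \<Otimes>\<^sub>M Q). pullback U \<phi> (fst p) (snd p) * f (fst p) * g (snd p)\<bar> \<le> cut_norm N U"
    using cut_norm_upper[of N U, OF N B f' g'] by simp
qed

section \<open>Monotonicity in the degree\<close>

locale prob_kernel = prob_space M for M :: "'a measure" +
  fixes W :: "'a \<Rightarrow> 'a \<Rightarrow> real"
  assumes kernel: "kernel_on M W"
begin

sublocale pair: pair_prob_space M M ..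

lemma kernel_measurable: "(\<lambda>p. W (fst p) (snd p)) \<in> borel_measurable (M \<Otimes>\<^sub>M M)"
  using kernel by (simp add: kernel_on_def case_prod_beta')

lemma measurable_compose_kernel[measurable (raw)]:
  assumes [measurable]: "f \<in> measurable K M" "g \<in> measurable K M"
  shows "(\<lambda>x. W (f x) (g x)) \<in> borel_measurable K"
  using measurable_compose[OF _ kernel_measurable, of "\<lambda>x. (f x, g x)" K] by simp

lemma kernel_sym: "x \<in> space M \<Longrightarrow> y \<in> space M \<Longrightarrow> W x y = W y x"
  using kernel by (simp add: kernel_on_def)

lemma kernel_bounds: "x \<in> space M \<Longrightarrow> y \<in> space M \<Longrightarrow> 0 \<le> W x y \<and> W x y \<le> 1"
  using kernel by (simp add: kernel_on_def)

definition mass :: "'a set \<Rightarrow> 'a \<Rightarrow> real" where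
  "mass A x = (LINT z:A|M. W x z)"

abbreviation degree :: "'a \<Rightarrow> real" where
  "degree \<equiv> mass (space M)"

text \<open>Each \<open>A\<close> has its own null set, because the integrals involved see only one
  \<open>A\<close> at a time; a common null set is available only for countably many sets.\<close>

definition degree_monotone :: bool where
  "degree_monotone \<longleftrightarrow> (\<forall>A\<in>sets M. AE p in M \<Otimes>\<^sub>M M.
     max (mass A (fst p) - mass A (snd p)) 0 \<le> max (degree (fst p) - degree (snd p)) 0)"

lemma mass_eq: "mass A x = (LINT z|M. indicator A z * W x z)"
  by (simp add: mass_def set_lebesgue_integral_def)

lemma mass_measurable[measurable]:
  assumes [measurable]: "A \<in> sets M"
  shows "mass A \<in> borel_measurable M"
  unfolding mass_eq by measurable

lemma mass_integrable:
  assumes "A \<in> sets M" "x \<in> space M"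
  shows "integrable M (\<lambda>z. indicator A z * W x z)"
  using assms kernel_bounds
  by (intro integrable_const_bound[where B = 1] AE_I2) (auto simp: indicator_def)

lemma mass_bounds:
  assumes "A \<in> sets M" "x \<in> space M"
  shows "0 \<le> mass A x \<and> mass A x \<le> 1"
proof
  show "0 \<le> mass A x"
    unfolding mass_eq using assms kernel_bounds by (intro integral_nonneg_AE AE_I2) auto
  have "mass A x \<le> (LINT z|M. 1)"
    unfolding mass_eq using assms kernel_bounds
    by (intro integral_mono mass_integrable) (auto simp: indicator_def)
  then show "mass A x \<le> 1" by (simp add: prob_space)
qed

lemma mass_compl:
  assumes A: "A \<in> sets M" and x: "x \<in> space M"
  shows "mass A x + mass (space M - A) x = degree x"
proof -
  have "mass A x + mass (space M - A) x
      = (LINT z|M. indicator A z * W x z + indicator (space M - A) z * W x z)"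
    unfolding mass_eq using assms
    by (intro Bochner_Integration.integral_add[symmetric] mass_integrable) auto
  also have "\<dots> = degree x"
    unfolding mass_eq by (intro Bochner_Integration.integral_cong) (auto simp: indicator_def)
  finally show ?thesis .
qed

abbreviation defect :: "'a set \<Rightarrow> 'a \<times> 'a \<Rightarrow> real" where
  "defect A p \<equiv> max (max (mass A (fst p) - mass A (snd p)) 0 - max (degree (fst p) - degree (snd p)) 0) 0"

lemma defect_integrable: "A \<in> sets M \<Longrightarrow> integrable (M \<Otimes>\<^sub>M M) (defect A)"
proof (rule integrable_pair_bounded[where B = 1])
  fix x y assume "A \<in> sets M" "x \<in> space M" "y \<in> space M"
  then show "\<bar>defect A (x, y)\<bar> \<le> 1"
    using mass_bounds[of A x] mass_bounds[of A y] by (auto simp: max_def)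
qed (auto intro: prob_space_axioms)

text \<open>The almost sure inequality is recast as the vanishing of the integral of its violation,
  so that almost optimal orders and almost optimal couplings can be used with an error
  \<open>e\<close>.\<close>

lemma degree_monotoneI:
  assumes "\<And>A e. A \<in> sets M \<Longrightarrow> e > 0 \<Longrightarrow> integral\<^sup>L (M \<Otimes>\<^sub>M M) (defect A) \<le> e"
  shows degree_monotone
  unfolding degree_monotone_def
proof
  fix A assume A: "A \<in> sets M"
  have "integral\<^sup>L (M \<Otimes>\<^sub>M M) (defect A) \<le> 0"
    by (rule field_le_epsilon) (use assms[OF A] in simp)
  moreover have "integral\<^sup>L (M \<Otimes>\<^sub>M M) (defect A) \<ge> 0"
    by (rule integral_nonneg_AE) simp
  ultimately have "integral\<^sup>L (M \<Otimes>\<^sub>M M) (defect A) = 0" by linarith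
  then have "AE p in M \<Otimes>\<^sub>M M. defect A p = 0"
    by (subst (asm) integral_nonneg_eq_0_iff_AE[OF defect_integrable[OF A]]) simp_all
  then show "AE p in M \<Otimes>\<^sub>M M. max (mass A (fst p) - mass A (snd p)) 0
      \<le> max (degree (fst p) - degree (snd p)) 0"
    by eventually_elim (simp add: max_def split: if_splits)
qed

section \<open>The order by degree and the vanishing of \<open>Omega1\<close>\<close>

definition degree_order :: "('a \<times> 'a) set \<Rightarrow> ('a \<times> 'a) set" where
  "degree_order r = {p \<in> space (M \<Otimes>\<^sub>M M). degree (fst p) < degree (snd p)} \<union>
     ({p \<in> space (M \<Otimes>\<^sub>M M). degree (fst p) = degree (snd p)} \<inter> r)"

lemma measurable_order_degree_order:
  assumes "measurable_order M r"
  shows "measurable_order M (degree_order r)"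
proof -
  have slo: "trans r" "irrefl r" "total_on (space M) r" and r[measurable]: "r \<in> sets (M \<Otimes>\<^sub>M M)"
    using assms by (auto simp: measurable_order_def strict_linear_order_on_def)
  have "trans (degree_order r)"
    unfolding degree_order_def using slo(1) by (auto simp: trans_def space_pair_measure)
  moreover have "irrefl (degree_order r)"
    using slo(2) by (auto simp: irrefl_def degree_order_def)
  moreover have "total_on (space M) (degree_order r)"
    unfolding total_on_def degree_order_def space_pair_measure
  proof (intro ballI impI)
    fix x y assume "x \<in> space M" "y \<in> space M" "x \<noteq> y"
    with slo(3) show "(x, y) \<in> {p \<in> space M \<times> space M. degree (fst p) < degree (snd p)} \<union>
        ({p \<in> space M \<times> space M. degree (fst p) = degree (snd p)} \<inter> r) \<or>
      (y, x) \<in> {p \<in> space M \<times> space M. degree (fst p) < degree (snd p)} \<union>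
        ({p \<in> space M \<times> space M. degree (fst p) = degree (snd p)} \<inter> r)"
      by (cases "degree x" "degree y" rule: linorder_cases) (auto simp: total_on_def)
  qed
  moreover have "degree_order r \<in> sets (M \<Otimes>\<^sub>M M)"
    unfolding degree_order_def by measurable
  ultimately show ?thesis
    by (simp add: measurable_order_def strict_linear_order_on_def)
qed

lemma Omega1_on_eq:
  "Omega1_on M W r A = (LINT p|(M \<Otimes>\<^sub>M M). indicator r p * max (mass A (fst p) - mass A (snd p)) 0)"
  by (simp add: Omega1_on_def set_lebesgue_integral_def mass_def case_prod_beta')

lemma Omega1_integrable:
  assumes [measurable]: "r \<in> sets (M \<Otimes>\<^sub>M M)" "A \<in> sets M"
  shows "integrable (M \<Otimes>\<^sub>M M) (\<lambda>p. indicator r p * max (mass A (fst p) - mass A (snd p)) 0)"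
proof (rule integrable_pair_bounded[where B = 1])
  fix x y assume "x \<in> space M" "y \<in> space M"
  then show "\<bar>indicator r (x, y) * max (mass A (fst (x, y)) - mass A (snd (x, y))) 0\<bar> \<le> 1"
    using mass_bounds[of A x] mass_bounds[of A y] by (auto simp: max_def indicator_def)
qed (auto intro: prob_space_axioms)

lemma Omega1_on_bounds:
  assumes r: "r \<in> sets (M \<Otimes>\<^sub>M M)" and A: "A \<in> sets M"
  shows "0 \<le> Omega1_on M W r A \<and> Omega1_on M W r A \<le> 1"
proof
  show "0 \<le> Omega1_on M W r A" unfolding Omega1_on_eq by (rule integral_nonneg_AE) simp
  have "Omega1_on M W r A \<le> (LINT p|(M \<Otimes>\<^sub>M M). 1)"
    unfolding Omega1_on_eq
  proof (rule integral_mono[OF Omega1_integrable[OF assms]])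
    fix p assume "p \<in> space (M \<Otimes>\<^sub>M M)"
    then show "indicator r p * max (mass A (fst p) - mass A (snd p)) 0 \<le> 1"
      using mass_bounds[OF A, of "fst p"] mass_bounds[OF A, of "snd p"]
      by (auto simp: space_pair_measure indicator_def)
  qed simp
  then show "Omega1_on M W r A \<le> 1" by (simp add: pair.prob_space)
qed

lemma Omega1_order_upper:
  assumes "r \<in> sets (M \<Otimes>\<^sub>M M)" "A \<in> sets M"
  shows "Omega1_on M W r A \<le> Omega1_order M W r"
  unfolding Omega1_order_def using assms Omega1_on_bounds
  by (intro cSUP_upper bdd_aboveI[of _ 1]) auto

lemma Omega1_order_nonneg: "r \<in> sets (M \<Otimes>\<^sub>M M) \<Longrightarrow> 0 \<le> Omega1_order M W r"
  using Omega1_order_upper[of r "{}"] Omega1_on_bounds[of r "{}"] by simp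

text \<open>If \<open>x\<close> precedes \<open>y\<close> in the degree order, then the degree of
  \<open>x\<close> is at most that of \<open>y\<close>, so the right-hand side of the condition is 0
  and the integrand of \<open>Omega1_on\<close> vanishes almost everywhere, for every
  \<open>A\<close> with the same order.\<close>

lemma degree_monotone_imp_Omega1_eq_0:
  assumes dm: degree_monotone and r: "measurable_order M r"
  shows "Omega1 M W = 0"
proof -
  let ?r = "degree_order r"
  have mo: "measurable_order M ?r" using r by (rule measurable_order_degree_order)
  have "Omega1_order M W ?r \<le> 0"
    unfolding Omega1_order_def
  proof (rule cSUP_least)
    fix A assume A: "A \<in> sets M"
    have "AE p in M \<Otimes>\<^sub>M M. indicator ?r p * max (mass A (fst p) - mass A (snd p)) 0 = 0"
      using dm A unfolding degree_monotone_def by (auto elim!: eventually_mono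
        simp: degree_order_def indicator_def max_def split: if_splits)
    then have "Omega1_on M W ?r A = 0"
      unfolding Omega1_on_eq by (rule integral_eq_zero_AE)
    then show "Omega1_on M W ?r A \<le> 0" by simp
  qed auto
  moreover have "Omega1 M W \<le> Omega1_order M W ?r"
    unfolding Omega1_def using mo Omega1_order_nonneg
    by (intro cINF_lower bdd_belowI[of _ 0]) (auto simp: measurable_order_def)
  moreover have "0 \<le> Omega1 M W"
    unfolding Omega1_def using mo Omega1_order_nonneg
    by (intro cINF_greatest) (auto simp: measurable_order_def)
  ultimately show ?thesis by linarith
qed

text \<open>Every pair of distinct points is ordered one way or the other. If \<open>x\<close>
  precedes \<open>y\<close>, the defect is at most the positive part of
  \<open>mass A x - mass A y\<close>. If \<open>y\<close> precedes \<open>x\<close>, the identity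
  \<open>mass A x - mass A y = (degree x - degree y) + (mass C y - mass C x)\<close>, with
  \<open>C\<close> the complement of \<open>A\<close>, bounds it by the positive part of the last
  bracket. The second case is integrated after swapping coordinates.\<close>

lemma Omega1_eq_0_imp_degree_monotone:
  assumes O: "Omega1 M W = 0" and ex: "\<exists>r. measurable_order M r"
  shows degree_monotone
proof (rule degree_monotoneI)
  fix A and e :: real assume A: "A \<in> sets M" and e: "e > 0"
  \<comment> \<open>The infimum over orders is not yet known to be attained, so an almost optimal
    order is taken; \<open>A\<close> and its complement each cost \<open>e / 2\<close>.\<close>
  have "\<exists>r. measurable_order M r \<and> Omega1_order M W r < e / 2"
    using cInf_lessD[of "Omega1_order M W ` {r. measurable_order M r}" "e / 2"] O ex e
    unfolding Omega1_def by auto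
  then obtain r where mo: "measurable_order M r" and r: "Omega1_order M W r < e / 2" by blast
  have rs[measurable]: "r \<in> sets (M \<Otimes>\<^sub>M M)" and tot: "total_on (space M) r"
    using mo by (auto simp: measurable_order_def strict_linear_order_on_def)
  let ?C = "space M - A"
  let ?f = "\<lambda>B p. indicator r p * max (mass B (fst p) - mass B (snd p)) 0"
  have C: "?C \<in> sets M" using A by auto
  have sw: "(LINT p|(M \<Otimes>\<^sub>M M). ?f ?C (prod.swap p)) = integral\<^sup>L (M \<Otimes>\<^sub>M M) (?f ?C)"
    using pair.integral_product_swap[of "?f ?C"] Omega1_integrable[OF rs C]
    by (simp add: prod.swap_def case_prod_beta')
  have isw: "integrable (M \<Otimes>\<^sub>M M) (\<lambda>p. ?f ?C (prod.swap p))"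
    using pair.integrable_product_swap[OF Omega1_integrable[OF rs C]]
    by (simp add: prod.swap_def case_prod_beta')
  have "integral\<^sup>L (M \<Otimes>\<^sub>M M) (defect A)
     \<le> (LINT p|(M \<Otimes>\<^sub>M M). ?f A p + ?f ?C (prod.swap p))"
  proof (rule integral_mono)
    fix p assume "p \<in> space (M \<Otimes>\<^sub>M M)"
    then obtain x y where p: "p = (x, y)" and xy: "x \<in> space M" "y \<in> space M"
      by (auto simp: space_pair_measure)
    have "x = y \<or> (x, y) \<in> r \<or> (y, x) \<in> r"
      using tot xy by (auto simp: total_on_def)
    moreover have "mass ?C x = degree x - mass A x" "mass ?C y = degree y - mass A y"
      using mass_compl[OF A xy(1)] mass_compl[OF A xy(2)] by auto
    ultimately show "defect A p \<le> ?f A p + ?f ?C (prod.swap p)"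
      by (auto simp: p indicator_def max_def)
  qed (use defect_integrable[OF A] Omega1_integrable[OF rs A] isw in auto)
  also have "\<dots> = Omega1_on M W r A + Omega1_on M W r ?C"
    unfolding Omega1_on_eq using Omega1_integrable[OF rs A] isw
    by (simp only: Bochner_Integration.integral_add sw)
  also have "\<dots> \<le> e"
    using Omega1_order_upper[OF rs A] Omega1_order_upper[OF rs C] r by linarith
  finally show "integral\<^sup>L (M \<Otimes>\<^sub>M M) (defect A) \<le> e" .
qed

end

section \<open>Transfer of degree monotonicity along equivalence\<close>

lemma measure_preserving_pair:
  assumes "prob_space Q" "prob_space M" and mp: "measure_preserving Q M \<phi>"
  shows "measure_preserving (Q \<Otimes>\<^sub>M Q) (M \<Otimes>\<^sub>M M) (\<lambda>p. (\<phi> (fst p), \<phi> (snd p)))"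
proof -
  interpret M: prob_space M by fact
  have [measurable]: "\<phi> \<in> measurable Q M" and d: "distr Q M \<phi> = M"
    using mp by (auto simp: measure_preserving_def)
  have "M \<Otimes>\<^sub>M M = distr (Q \<Otimes>\<^sub>M Q) (M \<Otimes>\<^sub>M M) (\<lambda>(x, y). (\<phi> x, \<phi> y))"
    using pair_measure_distr[of \<phi> Q M \<phi> Q M] M.sigma_finite_measure_axioms by (simp add: d)
  then show ?thesis
    by (simp add: measure_preserving_def case_prod_beta')
qed

text \<open>The product measure is a coupling, so the infimum ranges over a nonempty set and
  near-minimizers exist.\<close>

lemma ex_coupling_near_cut_dist:
  fixes M :: "'a measure" and N :: "'b measure"
  assumes "prob_space M" "prob_space N" "cut_dist M W N V < e"
  shows "\<exists>(Q :: ('a \<times> 'b) measure) \<phi> \<psi>. prob_space Q \<and> measure_preserving Q M \<phi> \<and>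
    measure_preserving Q N \<psi> \<and> cut_norm Q (\<lambda>x y. pullback W \<phi> x y - pullback V \<psi> x y) < e"
proof -
  interpret M: prob_space M by fact
  interpret N: prob_space N by fact
  interpret P: pair_prob_space M N ..
  interpret P': pair_prob_space N M ..
  have "distr (M \<Otimes>\<^sub>M N) M fst = M" by (rule N.distr_pair_fst)
  moreover have "distr (M \<Otimes>\<^sub>M N) N snd = N"
  proof -
    have "distr (M \<Otimes>\<^sub>M N) N snd = distr (N \<Otimes>\<^sub>M M) N fst"
      by (subst P.distr_pair_swap) (simp add: distr_distr comp_def case_prod_beta')
    then show ?thesis by (simp add: M.distr_pair_fst)
  qed
  ultimately have "(M \<Otimes>\<^sub>M N, fst, snd) \<in> {(Q :: ('a \<times> 'b) measure, \<phi>, \<psi>).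
      prob_space Q \<and> measure_preserving Q M \<phi> \<and> measure_preserving Q N \<psi>}"
    by (auto simp: measure_preserving_def P.prob_space_axioms)
  then show ?thesis
    using cInf_lessD[OF _ assms(3)[unfolded cut_dist_def]] by fastforce
qed

text \<open>The exact inequality is proved on a coupling for functions built from \<open>V\<close>,
  and is then transferred to \<open>W\<close> up to an L1-error controlled by the cut norm.\<close>

lemma equivalent_to_monotone_imp_degree_monotone:
  fixes M :: "'a measure" and N :: "'b measure"
  assumes "prob_kernel M W" and N: "ordered_prob_space N r" "monotone_kernel N r V"
    and eq: "kernel_equiv M W N V"
  shows "prob_kernel.degree_monotone M W"
proof -
  interpret M: prob_kernel M W by fact
  have mono: "V x1 y1 \<le> V x2 y2" if "x1 \<in> space N" "x2 \<in> space N" "y1 \<in> space N" "y2 \<in> space N"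
    "(x1, x2) \<in> r\<^sup>=" "(y1, y2) \<in> r\<^sup>=" for x1 x2 y1 y2
    using N(2) that unfolding monotone_kernel_def by metis
  interpret N: prob_kernel N V
    using N by (auto simp: ordered_prob_space_def monotone_kernel_def prob_kernel_def prob_kernel_axioms_def)
  have tot: "total_on (space N) r"
    using N(1) by (simp add: ordered_prob_space_def measurable_order_def strict_linear_order_on_def)
  show ?thesis
  proof (rule M.degree_monotoneI)
    fix A and e :: real assume A[measurable]: "A \<in> sets M" and e: "e > 0"
    \<comment> \<open>Four errors arise: for \<open>A\<close> and for the whole space, each at both
      coordinates of a pair.\<close>
    have "cut_dist M W N V < e / 4" using eq e by (simp add: kernel_equiv_def)
    from ex_coupling_near_cut_dist[OF M.prob_space_axioms N.prob_space_axioms this]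
    obtain Q :: "('a \<times> 'b) measure" and \<phi> \<psi> where Q: "prob_space Q"
      and \<phi>: "measure_preserving Q M \<phi>" and \<psi>: "measure_preserving Q N \<psi>"
      and cut: "cut_norm Q (\<lambda>x y. pullback W \<phi> x y - pullback V \<psi> x y) < e / 4"
      by blast
    interpret Q: prob_space Q by fact
    interpret QQ: pair_prob_space Q Q ..
    have [measurable]: "\<phi> \<in> measurable Q M" "\<psi> \<in> measurable Q N"
      using \<phi> \<psi> by (auto simp: measure_preserving_def)
    have \<phi>s: "\<phi> q \<in> space M" and \<psi>s: "\<psi> q \<in> space N" if "q \<in> space Q" for q
      using that by (auto intro: measurable_space[OF \<open>\<phi> \<in> measurable Q M\<close>]
        measurable_space[OF \<open>\<psi> \<in> measurable Q N\<close>])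
    \<comment> \<open>The counterpart of \<open>mass B\<close> on the coupling: the kernel is
      \<open>V\<close>, read through \<open>\<psi>\<close>, while the set \<open>B\<close> still
      lies in \<open>M\<close> and is read through \<open>\<phi>\<close>.\<close>
    define f where "f = (\<lambda>B p. LINT q|Q. indicator B (\<phi> q) * V (\<psi> p) (\<psi> q))"
    have f_measurable[measurable]: "f B \<in> borel_measurable Q" if [measurable]: "B \<in> sets M" for B
      unfolding f_def by measurable
    have f_int: "integrable Q (\<lambda>q. indicator B (\<phi> q) * V (\<psi> p) (\<psi> q))"
      if [measurable]: "B \<in> sets M" and p: "p \<in> space Q" for B p
    proof (intro Q.integrable_const_bound[where B = 1] AE_I2)
      fix q assume "q \<in> space Q"
      then show "norm (indicator B (\<phi> q) * V (\<psi> p) (\<psi> q)) \<le> 1"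
        using N.kernel_bounds[OF \<psi>s[OF p] \<psi>s] by (auto simp: indicator_def)
    qed (use \<psi>s[OF p] in measurable)
    have g_int: "integrable Q (\<lambda>q. indicator B (\<phi> q) * W (\<phi> p) (\<phi> q))"
      if [measurable]: "B \<in> sets M" and p: "p \<in> space Q" for B p
    proof (intro Q.integrable_const_bound[where B = 1] AE_I2)
      fix q assume "q \<in> space Q"
      then show "norm (indicator B (\<phi> q) * W (\<phi> p) (\<phi> q)) \<le> 1"
        using M.kernel_bounds[OF \<phi>s[OF p] \<phi>s] by (auto simp: indicator_def)
    qed (use \<phi>s[OF p] in measurable)
    have mass_f: "(LINT p|Q. \<bar>M.mass B (\<phi> p) - f B p\<bar>) \<le> e / 4" if B[measurable]: "B \<in> sets M" for B
    proof -
      have "(LINT p|Q. \<bar>M.mass B (\<phi> p) - f B p\<bar>)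
        = (LINT p|Q. \<bar>LINT q|Q. (pullback W \<phi> p q - pullback V \<psi> p q) * indicator B (\<phi> q)\<bar>)"
      proof (rule Bochner_Integration.integral_cong[OF refl])
        fix p assume p: "p \<in> space Q"
        have "M.mass B (\<phi> p) = (LINT q|Q. indicator B (\<phi> q) * W (\<phi> p) (\<phi> q))"
          unfolding M.mass_eq using \<phi>s[OF p]
          by (intro measure_preserving_integral[OF \<phi>, symmetric]) measurable
        then have "M.mass B (\<phi> p) - f B p
          = (LINT q|Q. indicator B (\<phi> q) * W (\<phi> p) (\<phi> q) - indicator B (\<phi> q) * V (\<psi> p) (\<psi> q))"
          unfolding f_def using f_int[OF B p] g_int[OF B p] by simp
        also have "\<dots> = (LINT q|Q. (pullback W \<phi> p q - pullback V \<psi> p q) * indicator B (\<phi> q))"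
          by (intro Bochner_Integration.integral_cong) (auto simp: pullback_def indicator_def)
        finally show "\<bar>M.mass B (\<phi> p) - f B p\<bar>
          = \<bar>LINT q|Q. (pullback W \<phi> p q - pullback V \<psi> p q) * indicator B (\<phi> q)\<bar>" by simp
      qed
      also have "\<dots> \<le> cut_norm Q (\<lambda>x y. pullback W \<phi> x y - pullback V \<psi> x y)"
      proof (rule cut_norm_section[OF Q _ kernel_diff_bound[OF M.kernel N.kernel \<phi> \<psi>]])
        show "(\<lambda>p. pullback W \<phi> (fst p) (snd p) - pullback V \<psi> (fst p) (snd p))
            \<in> borel_measurable (Q \<Otimes>\<^sub>M Q)"
          unfolding pullback_def by measurable
        show "(\<lambda>q. indicator B (\<phi> q)) \<in> cut_test Q"
          unfolding cut_test_def by (auto simp: indicator_def)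
      qed
      finally show ?thesis using cut by linarith
    qed
    \<comment> \<open>The second inequality is monotonicity of the part of the integral over the
      complement of \<open>A\<close>.\<close>
    have f_mono: "f A p \<le> f A q \<and> f A q - f A p \<le> f (space M) q - f (space M) p"
      if p: "p \<in> space Q" and q: "q \<in> space Q" and r: "(\<psi> p, \<psi> q) \<in> r\<^sup>=" for p q
    proof -
      have le: "V (\<psi> p) (\<psi> z) \<le> V (\<psi> q) (\<psi> z)" if "z \<in> space Q" for z
        using mono[OF \<psi>s[OF p] \<psi>s[OF q] \<psi>s[OF that] \<psi>s[OF that] r] by simp
      have "f A p \<le> f A q"
        unfolding f_def using le
        by (intro integral_mono f_int A p q mult_left_mono) auto
      moreover have "(LINT z|Q. indicator A (\<phi> z) * V (\<psi> q) (\<psi> z) - indicator A (\<phi> z) * V (\<psi> p) (\<psi> z))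
        \<le> (LINT z|Q. indicator (space M) (\<phi> z) * V (\<psi> q) (\<psi> z) - indicator (space M) (\<phi> z) * V (\<psi> p) (\<psi> z))"
        using le \<phi>s p q
        by (intro integral_mono Bochner_Integration.integrable_diff f_int A sets.top) (auto simp: indicator_def)
      then have "f A q - f A p \<le> f (space M) q - f (space M) p"
        unfolding f_def using f_int[OF A p] f_int[OF A q] f_int[OF sets.top p] f_int[OF sets.top q] by simp
      ultimately show ?thesis by simp
    qed
    let ?h = "\<lambda>p. \<bar>M.mass A (\<phi> p) - f A p\<bar> + \<bar>M.degree (\<phi> p) - f (space M) p\<bar>"
    have h_int: "integrable Q (\<lambda>p. \<bar>M.mass B (\<phi> p) - f B p\<bar>)" if B: "B \<in> sets M" for B
    proof (intro Q.integrable_const_bound[where B = 1] AE_I2)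
      fix p assume p: "p \<in> space Q"
      have "f B p \<le> (LINT q|Q. 1)"
        unfolding f_def using N.kernel_bounds[OF \<psi>s[OF p] \<psi>s]
        by (intro integral_mono f_int B p) (auto simp: indicator_def)
      moreover have "0 \<le> f B p"
        unfolding f_def using N.kernel_bounds[OF \<psi>s[OF p] \<psi>s]
        by (intro integral_nonneg_AE AE_I2) auto
      ultimately show "norm \<bar>M.mass B (\<phi> p) - f B p\<bar> \<le> 1"
        using M.mass_bounds[OF B \<phi>s[OF p]] by (auto simp: Q.prob_space abs_le_iff)
    qed (use B in measurable)
    have hi: "integrable Q ?h" using h_int[OF A] h_int[OF sets.top] by simp
    have hle: "(LINT p|Q. ?h p) \<le> e / 2"
      using mass_f[OF A] mass_f[OF sets.top] h_int[OF A] h_int[OF sets.top] by simp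
    have hQ: "integrable (Q \<Otimes>\<^sub>M Q) (\<lambda>p. ?h (fst p))" "integrable (Q \<Otimes>\<^sub>M Q) (\<lambda>p. ?h (snd p))"
      "(LINT p|(Q \<Otimes>\<^sub>M Q). ?h (fst p)) = (LINT p|Q. ?h p)"
      "(LINT p|(Q \<Otimes>\<^sub>M Q). ?h (snd p)) = (LINT p|Q. ?h p)"
    proof -
      show i: "integrable (Q \<Otimes>\<^sub>M Q) (\<lambda>p. ?h (fst p))"
        using integrable_distr[of fst "Q \<Otimes>\<^sub>M Q" Q ?h] hi by (simp add: Q.distr_pair_fst)
      from QQ.integrable_product_swap[OF this]
      show i2: "integrable (Q \<Otimes>\<^sub>M Q) (\<lambda>p. ?h (snd p))" by (simp add: case_prod_beta')
      show "(LINT p|(Q \<Otimes>\<^sub>M Q). ?h (fst p)) = (LINT p|Q. ?h p)"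
        "(LINT p|(Q \<Otimes>\<^sub>M Q). ?h (snd p)) = (LINT p|Q. ?h p)"
        using QQ.integral_fst'[OF i] QQ.integral_fst'[OF i2] by (simp_all add: Q.prob_space)
    qed
    have mp2: "measure_preserving (Q \<Otimes>\<^sub>M Q) (M \<Otimes>\<^sub>M M) (\<lambda>p. (\<phi> (fst p), \<phi> (snd p)))"
      by (rule measure_preserving_pair[OF Q M.prob_space_axioms \<phi>])
    have "integral\<^sup>L (M \<Otimes>\<^sub>M M) (M.defect A)
        = (LINT p|(Q \<Otimes>\<^sub>M Q). M.defect A (\<phi> (fst p), \<phi> (snd p)))"
      by (rule measure_preserving_integral[OF mp2, symmetric]) measurable
    also have "\<dots> \<le> (LINT p|(Q \<Otimes>\<^sub>M Q). ?h (fst p) + ?h (snd p))"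
    proof (rule integral_mono)
      show "integrable (Q \<Otimes>\<^sub>M Q) (\<lambda>p. M.defect A (\<phi> (fst p), \<phi> (snd p)))"
        using mp2 M.defect_integrable[OF A] integrable_distr[of "\<lambda>p. (\<phi> (fst p), \<phi> (snd p))" "Q \<Otimes>\<^sub>M Q" "M \<Otimes>\<^sub>M M" "M.defect A"]
        by (simp add: measure_preserving_def)
      show "integrable (Q \<Otimes>\<^sub>M Q) (\<lambda>p. ?h (fst p) + ?h (snd p))" using hQ by simp
      fix p assume "p \<in> space (Q \<Otimes>\<^sub>M Q)"
      then obtain x y where p: "p = (x, y)" and xy: "x \<in> space Q" "y \<in> space Q"
        by (auto simp: space_pair_measure)
      have "(\<psi> x, \<psi> y) \<in> r\<^sup>= \<or> (\<psi> y, \<psi> x) \<in> r\<^sup>="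
        using tot \<psi>s[OF xy(1)] \<psi>s[OF xy(2)] by (auto simp: total_on_def)
      \<comment> \<open>Whichever of \<open>\<psi> x\<close>, \<open>\<psi> y\<close> is the lower
        one, the condition holds exactly for \<open>f\<close>; the defect for \<open>W\<close> is
        therefore at most the four replacement errors.\<close>
      then have "max (f A x - f A y) 0 \<le> max (f (space M) x - f (space M) y) 0"
        using f_mono[OF xy] f_mono[OF xy(2,1)] by auto
      then show "M.defect A (\<phi> (fst p), \<phi> (snd p)) \<le> ?h (fst p) + ?h (snd p)"
        unfolding p fst_conv snd_conv by linarith
    qed
    also have "\<dots> \<le> e" using hQ hle by (simp only: Bochner_Integration.integral_add)
    finally show "integral\<^sup>L (M \<Otimes>\<^sub>M M) (M.defect A) \<le> e" .
  qed
qed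

section \<open>The kernel as a function of the degrees\<close>

text \<open>Almost no point with property \<open>B\<close> lies at a height up to which
  \<open>B\<close> has probability zero. This is what places the value of the kernel at a typical
  point below an essential supremum over a closed quadrant.\<close>

lemma (in prob_space) AE_pos_prob_below:
  fixes f :: "'a \<Rightarrow> real"
  shows "AE x in M. B x \<longrightarrow> \<not> (AE x' in M. \<not> (B x' \<and> f x' \<le> f x))"
proof -
  \<comment> \<open>The thresholds up to which \<open>B\<close> is null form a down-set. Its
    rational members cover every \<open>f x\<close> that is not the largest element of
    \<open>Z\<close>; a largest element, if there is one, contributes a single further null
    set.\<close>
  define Z where "Z = {s. AE x' in M. \<not> (B x' \<and> f x' \<le> s)}"
  have down: "s \<in> Z" if "t \<in> Z" "s \<le> t" for s t
    using that(1) unfolding Z_def mem_Collect_eq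
    by (rule eventually_mono) (use that(2) in auto)
  have "AE x in M. \<forall>s\<in>\<rat> \<inter> Z. \<not> (B x \<and> f x \<le> s)"
    using countable_rat by (subst AE_ball_countable) (auto simp: Z_def countable_Int1)
  moreover have "AE x in M. \<forall>m. m \<in> Z \<and> (\<forall>z\<in>Z. z \<le> m) \<longrightarrow> \<not> (B x \<and> f x \<le> m)"
  proof (cases "\<exists>m\<in>Z. \<forall>z\<in>Z. z \<le> m")
    case True
    then obtain m where m: "m \<in> Z" "\<forall>z\<in>Z. z \<le> m" by blast
    then have "AE x in M. \<not> (B x \<and> f x \<le> m)" by (simp add: Z_def)
    then show ?thesis by (rule eventually_mono) (use m in \<open>auto intro: antisym\<close>)
  qed auto
  ultimately have "AE x in M. B x \<longrightarrow> f x \<notin> Z"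
  proof eventually_elim
    case (elim x)
    show ?case
    proof (intro impI notI)
      assume "B x" and Z: "f x \<in> Z"
      show False
      proof (cases "\<forall>z\<in>Z. z \<le> f x")
        case True
        then show False using elim(2) \<open>B x\<close> Z by blast
      next
        case False
        then obtain z where "z \<in> Z" "f x < z" by force
        then obtain s where "s \<in> \<rat>" "f x < s" "s < z" using Rats_dense_in_real by blast
        then show False
          using elim(1)[rule_format, of s] \<open>B x\<close> \<open>z \<in> Z\<close> down[of z s] by auto
      qed
    qed
  qed
  then show ?thesis by (simp add: Z_def)
qed

context prob_kernel
begin

text \<open>Applying the condition to the complement of \<open>A\<close> reverses the roles of the
  two points, which saves a swap of coordinates.\<close>

lemma degree_monotone_mass:
  assumes degree_monotone and A: "A \<in> sets M"
  shows "AE p in M \<Otimes>\<^sub>M M. degree (snd p) \<le> degree (fst p) \<longrightarrow> mass A (snd p) \<le> mass A (fst p)"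
proof -
  have "space M - A \<in> sets M" using A by auto
  then have "AE p in M \<Otimes>\<^sub>M M. max (mass (space M - A) (fst p) - mass (space M - A) (snd p)) 0
      \<le> max (degree (fst p) - degree (snd p)) 0"
    using assms(1) unfolding degree_monotone_def by blast
  then show ?thesis
    using AE_space
  proof eventually_elim
    case (elim p)
    then have "mass (space M - A) (fst p) = degree (fst p) - mass A (fst p)"
      "mass (space M - A) (snd p) = degree (snd p) - mass A (snd p)"
      using mass_compl[OF A, of "fst p"] mass_compl[OF A, of "snd p"] by (auto simp: space_pair_measure)
    then show ?case using elim(1) by auto
  qed
qed

text \<open>Testing against measurable sets \<open>A\<close> yields the comparison of the sections of \<open>W\<close> themselves. As
  the sigma-algebra need not be countably generated, the exceptional set depending on \<open>A\<close> is removed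
  by step function approximation.\<close>

lemma degree_monotone_sections:
  assumes dm: degree_monotone
  shows "AE z in M. AE x in M. AE x' in M. degree x' \<le> degree x \<longrightarrow> W x' z \<le> W x z"
proof -
  interpret T: pair_prob_space "M \<Otimes>\<^sub>M M" M ..
  \<comment> \<open>A point \<open>q\<close> stands for \<open>((x, x'), z)\<close>, and a positive
    value of \<open>u\<close> is a violation. With \<open>g\<close> the indicator of
    \<open>u > 0\<close>, it suffices that the integral of \<open>u * g\<close> is not
    positive.\<close>
  define u where "u = (\<lambda>q. if degree (snd (fst q)) \<le> degree (fst (fst q))
    then W (snd (fst q)) (snd q) - W (fst (fst q)) (snd q) else 0)"
  have u_measurable[measurable]: "u \<in> borel_measurable ((M \<Otimes>\<^sub>M M) \<Otimes>\<^sub>M M)"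
    unfolding u_def by measurable
  have u_bound: "\<bar>u q\<bar> \<le> 1" if "q \<in> space ((M \<Otimes>\<^sub>M M) \<Otimes>\<^sub>M M)" for q
    using that kernel_bounds[of "fst (fst q)" "snd q"] kernel_bounds[of "snd (fst q)" "snd q"]
    by (auto simp: u_def space_pair_measure abs_le_iff)
  define g where "g = (\<lambda>q. if 0 < u q then 1 else 0 :: real)"
  have g_measurable[measurable]: "g \<in> borel_measurable ((M \<Otimes>\<^sub>M M) \<Otimes>\<^sub>M M)"
    unfolding g_def by measurable
  have g_int: "integrable ((M \<Otimes>\<^sub>M M) \<Otimes>\<^sub>M M) g"
    by (intro T.integrable_const_bound[where B = 1] AE_I2) (auto simp: g_def)
  have ug_int: "integrable ((M \<Otimes>\<^sub>M M) \<Otimes>\<^sub>M M) (\<lambda>q. u q * g q)"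
    using u_bound by (intro T.integrable_const_bound[where B = 1] AE_I2) (auto simp: g_def abs_le_iff)
  have "(LINT q|((M \<Otimes>\<^sub>M M) \<Otimes>\<^sub>M M). u q * g q) \<le> 0"
  proof (rule field_le_epsilon)
    fix e :: real assume e: "e > 0"
    have "step_approximable (M \<Otimes>\<^sub>M M) M g"
      by (rule step_approximable_integrable[OF pair.prob_space_axioms prob_space_axioms g_int])
    then obtain \<pi> :: "'a \<times> 'a \<Rightarrow> nat" and \<rho> :: "'a \<Rightarrow> nat" and T where
      m[measurable]: "\<pi> \<in> measurable (M \<Otimes>\<^sub>M M) (count_space UNIV)" "\<rho> \<in> measurable M (count_space UNIV)"
      and fin: "finite (range \<pi>)" "finite (range \<rho>)"
      and approx: "(LINT q|((M \<Otimes>\<^sub>M M) \<Otimes>\<^sub>M M). \<bar>g q - T (\<pi> (fst q)) (\<rho> (snd q))\<bar>) < e"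
      using e unfolding step_approximable_def by meson
    \<comment> \<open>Nonnegative weights are needed to keep the sign of each cell's contribution;
      since \<open>g\<close> is nonnegative, truncating at 0 does not increase the distance to
      \<open>g\<close>.\<close>
    define T' where "T' = (\<lambda>i j. max (T i j) 0)"
    let ?s = "\<lambda>T q. T (\<pi> (fst q)) (\<rho> (snd q)) :: real"
    note s_int = step_function_integrable[OF pair.prob_space_axioms prob_space_axioms m fin]
    have us_int: "integrable ((M \<Otimes>\<^sub>M M) \<Otimes>\<^sub>M M) (\<lambda>q. u q * ?s T' q)"
    proof (rule Bochner_Integration.integrable_bound[OF s_int[of T']])
      show "AE q in (M \<Otimes>\<^sub>M M) \<Otimes>\<^sub>M M. norm (u q * ?s T' q) \<le> norm (?s T' q)"
        using u_bound by (intro AE_I2) (simp add: abs_mult mult_left_le_one_le)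
      show "(\<lambda>q. u q * ?s T' q) \<in> borel_measurable ((M \<Otimes>\<^sub>M M) \<Otimes>\<^sub>M M)"
        using s_int[of T'] by (intro borel_measurable_times u_measurable) auto
    qed
    have "(LINT q|((M \<Otimes>\<^sub>M M) \<Otimes>\<^sub>M M). u q * ?s T' q)
        = (LINT p|(M \<Otimes>\<^sub>M M). LINT z|M. u (p, z) * T' (\<pi> p) (\<rho> z))"
      using T.integral_fst'[OF us_int] by simp
    also have "\<dots> \<le> 0"
    proof -
      \<comment> \<open>Only the sets \<open>\<rho> = j\<close> are tested, and there are countably
        many of them, so one null set of pairs serves all; outside it the inner integral is a
        nonnegative combination of nonpositive differences of masses.\<close>
      have Aj: "{z\<in>space M. \<rho> z = j} \<in> sets M" for j by measurable
      have "AE p in M \<Otimes>\<^sub>M M. \<forall>j. degree (snd p) \<le> degree (fst p) \<longrightarrow>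
          mass {z\<in>space M. \<rho> z = j} (snd p) \<le> mass {z\<in>space M. \<rho> z = j} (fst p)"
        by (subst AE_all_countable) (use degree_monotone_mass[OF dm Aj] in blast)
      then have "AE p in M \<Otimes>\<^sub>M M. 0 \<le> - (LINT z|M. u (p, z) * T' (\<pi> p) (\<rho> z))"
        unfolding neg_0_le_iff_le
        using AE_space
      proof eventually_elim
        case (elim p)
        then have p: "fst p \<in> space M" "snd p \<in> space M" by (auto simp: space_pair_measure)
        show ?case
        proof (cases "degree (snd p) \<le> degree (fst p)")
          case True
          let ?A = "\<lambda>j. {z\<in>space M. \<rho> z = j}"
          let ?f = "\<lambda>j z. indicator (?A j) z * W (snd p) z - indicator (?A j) z * W (fst p) z"
          have fi: "integrable M (?f j)" for j
            by (intro Bochner_Integration.integrable_diff mass_integrable Aj p)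
          have "(LINT z|M. u (p, z) * T' (\<pi> p) (\<rho> z)) = (LINT z|M. (\<Sum>j\<in>range \<rho>. T' (\<pi> p) j * ?f j z))"
          proof (rule Bochner_Integration.integral_cong[OF refl])
            fix z assume z: "z \<in> space M"
            have "(\<Sum>j\<in>range \<rho>. T' (\<pi> p) j * ?f j z) = (\<Sum>j\<in>range \<rho>. if j = \<rho> z
                then T' (\<pi> p) (\<rho> z) * (W (snd p) z - W (fst p) z) else 0)"
              using z by (intro sum.cong) (auto simp: indicator_def)
            then show "u (p, z) * T' (\<pi> p) (\<rho> z) = (\<Sum>j\<in>range \<rho>. T' (\<pi> p) j * ?f j z)"
              using fin True by (simp add: u_def mult.commute)
          qed
          also have "\<dots> = (\<Sum>j\<in>range \<rho>. T' (\<pi> p) j * (LINT z|M. ?f j z))"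
            using fi by (subst Bochner_Integration.integral_sum) auto
          also have "\<dots> = (\<Sum>j\<in>range \<rho>. T' (\<pi> p) j * (mass (?A j) (snd p) - mass (?A j) (fst p)))"
            unfolding mass_eq
            by (subst Bochner_Integration.integral_diff) (auto intro!: mass_integrable Aj p)
          also have "\<dots> \<le> 0"
            using elim(1) True by (intro sum_nonpos mult_nonneg_nonpos) (auto simp: T'_def)
          finally show ?thesis .
        next
          case False
          then show ?thesis by (simp add: u_def)
        qed
      qed
      from integral_nonneg_AE[OF this] show ?thesis by simp
    qed
    finally have 1: "(LINT q|((M \<Otimes>\<^sub>M M) \<Otimes>\<^sub>M M). u q * ?s T' q) \<le> 0" .
    have "(LINT q|((M \<Otimes>\<^sub>M M) \<Otimes>\<^sub>M M). u q * g q)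
        \<le> (LINT q|((M \<Otimes>\<^sub>M M) \<Otimes>\<^sub>M M). u q * ?s T' q + \<bar>g q - ?s T q\<bar>)"
    proof (rule integral_mono)
      fix q assume q: "q \<in> space ((M \<Otimes>\<^sub>M M) \<Otimes>\<^sub>M M)"
      have "u q * g q - u q * ?s T' q \<le> \<bar>u q\<bar> * \<bar>g q - ?s T' q\<bar>"
        by (simp flip: right_diff_distrib abs_mult)
      also have "\<dots> \<le> 1 * \<bar>g q - ?s T q\<bar>"
        using u_bound[OF q] by (intro mult_mono) (auto simp: T'_def g_def)
      finally show "u q * g q \<le> u q * ?s T' q + \<bar>g q - ?s T q\<bar>" by simp
    qed (use ug_int us_int g_int s_int[of T] in auto)
    also have "\<dots> \<le> 0 + e"
      using us_int g_int s_int[of T] 1 approx by (subst Bochner_Integration.integral_add) auto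
    finally show "(LINT q|((M \<Otimes>\<^sub>M M) \<Otimes>\<^sub>M M). u q * g q) \<le> 0 + e" .
  qed
  moreover have nn: "0 \<le> u q * g q" for q by (simp add: g_def)
  ultimately have "(LINT q|((M \<Otimes>\<^sub>M M) \<Otimes>\<^sub>M M). u q * g q) = 0"
    by (intro antisym integral_nonneg_AE) auto
  then have "AE q in (M \<Otimes>\<^sub>M M) \<Otimes>\<^sub>M M. u q * g q = 0"
    by (subst (asm) integral_nonneg_eq_0_iff_AE[OF ug_int]) (auto simp: nn)
  then have "AE q in (M \<Otimes>\<^sub>M M) \<Otimes>\<^sub>M M. degree (snd (fst q)) \<le> degree (fst (fst q)) \<longrightarrow>
      W (snd (fst q)) (snd q) \<le> W (fst (fst q)) (snd q)"
    by eventually_elim (auto simp: u_def g_def split: if_splits)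
  then have "AE p in M \<Otimes>\<^sub>M M. AE z in M. degree (snd p) \<le> degree (fst p) \<longrightarrow>
      W (snd p) z \<le> W (fst p) z"
    using T.AE_pair by fastforce
  then have "AE z in M. AE p in M \<Otimes>\<^sub>M M. degree (snd p) \<le> degree (fst p) \<longrightarrow>
      W (snd p) z \<le> W (fst p) z"
    by (subst (asm) T.AE_commute) measurable
  then show ?thesis
    by eventually_elim (use pair.AE_pair in fastforce)
qed

text \<open>Positivity of \<open>level c s t\<close> says that \<open>c\<close> is below the
  essential supremum of \<open>W\<close> over the closed quadrant of degrees at most
  \<open>s\<close> and \<open>t\<close>. Working with measures makes measurability in
  \<open>s\<close> and \<open>t\<close> immediate.\<close>

definition level :: "real \<Rightarrow> real \<Rightarrow> real \<Rightarrow> real" where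
  "level c s t = measure (M \<Otimes>\<^sub>M M)
     {p \<in> space (M \<Otimes>\<^sub>M M). c < W (fst p) (snd p) \<and> degree (fst p) \<le> s \<and> degree (snd p) \<le> t}"

definition section_level :: "real \<Rightarrow> 'a \<Rightarrow> real \<Rightarrow> real" where
  "section_level c x t = measure M {y \<in> space M. c < W x y \<and> degree y \<le> t}"

lemma section_level_measurable[measurable (raw)]:
  assumes [measurable]: "f \<in> measurable K M" "h \<in> borel_measurable K"
  shows "(\<lambda>x. section_level c (f x) (h x)) \<in> borel_measurable K"
proof -
  have "(\<lambda>x. emeasure M {y \<in> space M. c < W (f x) y \<and> degree y \<le> h x}) \<in> borel_measurable K"
    by measurable
  then show ?thesis unfolding section_level_def measure_def by measurable
qed

lemma level_measurable[measurable (raw)]: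
  assumes [measurable]: "f \<in> borel_measurable K" "h \<in> borel_measurable K"
  shows "(\<lambda>x. level c (f x) (h x)) \<in> borel_measurable K"
proof -
  have "(\<lambda>x. emeasure (M \<Otimes>\<^sub>M M) {p \<in> space (M \<Otimes>\<^sub>M M). c < W (fst p) (snd p) \<and>
      degree (fst p) \<le> f x \<and> degree (snd p) \<le> h x}) \<in> borel_measurable K"
    by measurable
  then show ?thesis unfolding level_def measure_def by measurable
qed

lemma section_level_pos_iff:
  assumes x: "x \<in> space M"
  shows "0 < section_level c x t \<longleftrightarrow> \<not> (AE y in M. \<not> (c < W x y \<and> degree y \<le> t))"
proof -
  have "{y \<in> space M. c < W x y \<and> degree y \<le> t} \<in> sets M" using x by measurable
  from prob_Collect_eq_0[OF this] show ?thesis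
    by (simp add: section_level_def zero_less_measure_iff measure_nonneg less_le)
qed

text \<open>Fubini splits the quadrant, so that arguments about one variable can be applied first to
  a section and then to the family of sections.\<close>

lemma level_pos_iff:
  "0 < level c s t \<longleftrightarrow> \<not> (AE x in M. \<not> (0 < section_level c x t \<and> degree x \<le> s))"
proof -
  have m: "{p \<in> space (M \<Otimes>\<^sub>M M). c < W (fst p) (snd p) \<and> degree (fst p) \<le> s \<and> degree (snd p) \<le> t}
      \<in> sets (M \<Otimes>\<^sub>M M)" by measurable
  have "level c s t = 0 \<longleftrightarrow>
      (AE p in M \<Otimes>\<^sub>M M. \<not> (c < W (fst p) (snd p) \<and> degree (fst p) \<le> s \<and> degree (snd p) \<le> t))"
    unfolding level_def by (rule pair.prob_Collect_eq_0[OF m])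
  also have "\<dots> \<longleftrightarrow> (AE x in M. AE y in M. \<not> (c < W x y \<and> degree x \<le> s \<and> degree y \<le> t))"
    by (rule pair.AE_pair_iff[symmetric]) measurable
  also have "\<dots> \<longleftrightarrow> (AE x in M. \<not> (0 < section_level c x t \<and> degree x \<le> s))"
  proof (rule AE_cong)
    fix x assume x: "x \<in> space M"
    show "(AE y in M. \<not> (c < W x y \<and> degree x \<le> s \<and> degree y \<le> t)) \<longleftrightarrow>
        \<not> (0 < section_level c x t \<and> degree x \<le> s)"
      unfolding section_level_pos_iff[OF x] by (cases "degree x \<le> s") auto
  qed
  finally have "level c s t = 0 \<longleftrightarrow> (AE x in M. \<not> (0 < section_level c x t \<and> degree x \<le> s))" .
  moreover have "0 \<le> level c s t" by (simp add: level_def)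
  ultimately show ?thesis by (simp add: less_le)
qed

lemma level_mono: "s \<le> s' \<Longrightarrow> t \<le> t' \<Longrightarrow> level c s t \<le> level c s' t'"
  unfolding level_def by (intro pair.finite_measure_mono) auto

lemma level_sym: "level c s t = level c t s"
proof -
  let ?S = "\<lambda>s t. {p \<in> space (M \<Otimes>\<^sub>M M). c < W (fst p) (snd p) \<and> degree (fst p) \<le> s \<and> degree (snd p) \<le> t}"
  have m: "?S s t \<in> sets (M \<Otimes>\<^sub>M M)" for s t by measurable
  have "level c s t = measure (distr (M \<Otimes>\<^sub>M M) (M \<Otimes>\<^sub>M M) (\<lambda>(x, y). (y, x))) (?S s t)"
    unfolding level_def by (subst pair.distr_pair_swap) simp
  also have "\<dots> = measure (M \<Otimes>\<^sub>M M) ((\<lambda>(x, y). (y, x)) -` ?S s t \<inter> space (M \<Otimes>\<^sub>M M))"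
    by (rule measure_distr[OF measurable_pair_swap' m])
  also have "(\<lambda>(x, y). (y, x)) -` ?S s t \<inter> space (M \<Otimes>\<^sub>M M) = ?S t s"
    using kernel_sym by (auto simp: space_pair_measure)
  finally show ?thesis by (simp add: level_def)
qed

text \<open>\<open>AE_pos_prob_below\<close> is applied twice: in the second variable to the
  property \<open>c < W x y\<close> for fixed \<open>x\<close>, then in the first variable to
  positivity of \<open>section_level\<close> for fixed \<open>y\<close>.\<close>

lemma kernel_le_level:
  "AE p in M \<Otimes>\<^sub>M M. c < W (fst p) (snd p) \<longrightarrow> 0 < level c (degree (fst p)) (degree (snd p))"
proof -
  have "AE p in M \<Otimes>\<^sub>M M. c < W (fst p) (snd p) \<longrightarrow> 0 < section_level c (fst p) (degree (snd p))"
  proof (subst pair.AE_pair_iff[symmetric])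
    show "AE x in M. AE y in M. c < W x y \<longrightarrow> 0 < section_level c x (degree y)"
      using AE_space
    proof eventually_elim
      case (elim x)
      then show ?case unfolding section_level_pos_iff[OF elim] by (intro AE_pos_prob_below)
    qed
  qed measurable
  moreover have "AE p in M \<Otimes>\<^sub>M M. 0 < section_level c (fst p) (degree (snd p)) \<longrightarrow>
      0 < level c (degree (fst p)) (degree (snd p))"
  proof (subst pair.AE_pair_iff[symmetric])
    have "AE y in M. AE x in M. 0 < section_level c x (degree y) \<longrightarrow> 0 < level c (degree x) (degree y)"
      unfolding level_pos_iff by (intro AE_I2 AE_pos_prob_below)
    then show "AE x in M. AE y in M. 0 < section_level c x (degree y) \<longrightarrow> 0 < level c (degree x) (degree y)"
      by (subst pair.AE_commute) measurable
  qed measurable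
  ultimately show ?thesis by eventually_elim simp
qed

text \<open>By contraposition, one variable at a time: if \<open>W z y \<le> c\<close>, then by the
  comparison of sections almost every point of degree at most \<open>degree y\<close> also has value
  at most \<open>c\<close> against \<open>z\<close>, so the section level is zero. Repeating this in
  the other variable makes the level zero.\<close>

lemma level_le_kernel:
  assumes degree_monotone
  shows "AE p in M \<Otimes>\<^sub>M M. 0 < level c (degree (fst p)) (degree (snd p)) \<longrightarrow> c < W (fst p) (snd p)"
proof (subst pair.AE_pair_iff[symmetric])
  note sections = degree_monotone_sections[OF assms]
  have "AE z in M. AE y in M. 0 < section_level c z (degree y) \<longrightarrow> c < W z y"
    using sections AE_space
  proof eventually_elim
    case (elim z)
    show ?case
      using elim(1) AE_space
    proof eventually_elim
      case (elim y)
      show ?case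
      proof (rule impI, rule ccontr)
        assume pos: "0 < section_level c z (degree y)" and n: "\<not> c < W z y"
        have "AE y' in M. \<not> (c < W z y' \<and> degree y' \<le> degree y)"
          using elim(1) AE_space
          by eventually_elim (use n \<open>z \<in> space M\<close> \<open>y \<in> space M\<close> kernel_sym in fastforce)
        then show False using pos section_level_pos_iff[OF \<open>z \<in> space M\<close>] by blast
      qed
    qed
  qed
  then have "AE y in M. AE z in M. 0 < section_level c z (degree y) \<longrightarrow> c < W z y"
    by (subst (asm) pair.AE_commute) measurable
  with sections have "AE y in M. AE x in M. 0 < level c (degree x) (degree y) \<longrightarrow> c < W x y"
  proof eventually_elim
    case (elim y)
    show ?case
      using elim(1)
    proof eventually_elim
      case (elim x)
      show ?case
      proof (rule impI, rule ccontr)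
        assume pos: "0 < level c (degree x) (degree y)" and n: "\<not> c < W x y"
        have "AE x' in M. \<not> (0 < section_level c x' (degree y) \<and> degree x' \<le> degree x)"
          using elim \<open>AE z in M. 0 < section_level c z (degree y) \<longrightarrow> c < W z y\<close>
          by eventually_elim (use n in auto)
        then show False using pos level_pos_iff by blast
      qed
    qed
  qed
  then show "AE x in M. AE y in M. 0 < level c (degree x) (degree y) \<longrightarrow> c < W x y"
    by (subst pair.AE_commute) measurable
qed measurable

text \<open>The essential supremum over the quadrant, cut off at 0. Rational \<open>c\<close> keep
  the supremum countable, hence measurable; the default 0 gives values in [0,1] even over null
  quadrants, so that this is a kernel on all of the reals.\<close>

definition profile :: "real \<Rightarrow> real \<Rightarrow> real" where
  "profile s t = (SUP c\<in>\<rat> \<inter> {0..1}. if 0 < level c s t then c else 0)"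

lemma profile_bdd: "bdd_above ((\<lambda>c. if 0 < level c s t then c else 0) ` (\<rat> \<inter> {0..1}))"
  by (rule bdd_aboveI[of _ 1]) auto

lemma profile_measurable: "(\<lambda>p. profile (fst p) (snd p)) \<in> borel_measurable (borel \<Otimes>\<^sub>M borel)"
proof -
  have "countable (\<rat> \<inter> {0..1 :: real})" by (simp add: countable_rat countable_Int1)
  then show ?thesis
    unfolding profile_def
    by (rule borel_measurable_cSUP) (use profile_bdd in auto)
qed

lemma profile_bounds: "0 \<le> profile s t \<and> profile s t \<le> 1"
proof
  show "0 \<le> profile s t"
    unfolding profile_def by (rule cSUP_upper2[OF profile_bdd, of 0]) auto
  show "profile s t \<le> 1"
    unfolding profile_def by (rule cSUP_least) (auto intro!: exI[of _ 0])
qed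

lemma profile_sym: "profile s t = profile t s"
  by (simp add: profile_def level_sym[of _ s t])

lemma profile_mono:
  assumes "s \<le> s'" "t \<le> t'"
  shows "profile s t \<le> profile s' t'"
  unfolding profile_def
proof (rule cSUP_mono[OF _ profile_bdd])
  show "\<exists>d\<in>\<rat> \<inter> {0..1}. (if 0 < level c s t then c else 0) \<le> (if 0 < level d s' t' then d else 0)"
    if "c \<in> \<rat> \<inter> {0..1}" for c
    using that level_mono[OF assms, of c] by (intro bexI[of _ c]) auto
qed (auto intro!: exI[of _ 0])

text \<open>One null set is discarded for each rational \<open>c\<close>; outside their union the
  same rationals lie below \<open>W\<close> and below the essential supremum.\<close>

lemma kernel_eq_profile:
  assumes degree_monotone
  shows "AE p in M \<Otimes>\<^sub>M M. W (fst p) (snd p) = profile (degree (fst p)) (degree (snd p))"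
proof -
  have "AE p in M \<Otimes>\<^sub>M M. \<forall>c\<in>\<rat>. 0 < level c (degree (fst p)) (degree (snd p)) \<longleftrightarrow> c < W (fst p) (snd p)"
  proof (subst AE_ball_countable[OF countable_rat], rule)
    fix c :: real
    show "AE p in M \<Otimes>\<^sub>M M. 0 < level c (degree (fst p)) (degree (snd p)) \<longleftrightarrow> c < W (fst p) (snd p)"
      using kernel_le_level[of c] level_le_kernel[OF assms, of c] by eventually_elim auto
  qed
  then show ?thesis
    using AE_space
  proof eventually_elim
    case (elim p)
    let ?w = "W (fst p) (snd p)"
    have w: "0 \<le> ?w" "?w \<le> 1" using elim(2) kernel_bounds by (auto simp: space_pair_measure)
    have P: "profile (degree (fst p)) (degree (snd p)) = (SUP c\<in>\<rat> \<inter> {0..1}. if c < ?w then c else 0)"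
      unfolding profile_def using elim(1) by (intro SUP_cong) auto
    have bdd: "bdd_above ((\<lambda>c. if c < ?w then c else 0) ` (\<rat> \<inter> {0..1}))"
      by (rule bdd_aboveI[of _ 1]) auto
    show ?case
    proof (rule antisym)
      show "profile (degree (fst p)) (degree (snd p)) \<le> ?w"
        unfolding P using w by (intro cSUP_least) (auto intro!: exI[of _ 0])
      show "?w \<le> profile (degree (fst p)) (degree (snd p))"
      proof (rule field_le_epsilon)
        fix e :: real assume "e > 0"
        show "?w \<le> profile (degree (fst p)) (degree (snd p)) + e"
        \<comment> \<open>If \<open>?w - e\<close> is nonnegative, a rational between it and
          \<open>?w\<close> automatically lies in [0,1] and is an admissible index; otherwise
          nonnegativity of \<open>profile\<close> is enough.\<close>
        proof (cases "?w - e < 0")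
          case True
          then show ?thesis using profile_bounds[of "degree (fst p)" "degree (snd p)"] by linarith
        next
          case False
          obtain c where c: "c \<in> \<rat>" "?w - e < c" "c < ?w" using Rats_dense_in_real[of "?w - e" ?w] \<open>e > 0\<close> by auto
          then have "c \<le> profile (degree (fst p)) (degree (snd p))"
            unfolding P using False w by (intro cSUP_upper2[OF bdd, of c]) auto
          then show ?thesis using c by linarith
        qed
      qed
    qed
  qed
qed

end

section \<open>Equivalence of kernels\<close>

lemma prob_kernelI: "prob_space M \<Longrightarrow> kernel_on M W \<Longrightarrow> prob_kernel M W"
  by (simp add: prob_kernel_def prob_kernel_axioms_def)

lemma measure_preserving_compose:
  assumes "measure_preserving R Q \<alpha>" "measure_preserving Q M \<phi>"
  shows "measure_preserving R M (\<lambda>x. \<phi> (\<alpha> x))"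
  using assms distr_distr[of \<phi> Q M \<alpha> R] by (auto simp: measure_preserving_def comp_def)

lemma measure_preserving_integrable:
  assumes "measure_preserving Q M \<phi>" "integrable M f"
  shows "integrable Q (\<lambda>q. f (\<phi> q) :: real)"
  using assms integrable_distr[of \<phi> Q M f] by (simp add: measure_preserving_def)

lemma cut_norm_diff_commute:
  "cut_norm N (\<lambda>x y. U x y - V x y) = cut_norm N (\<lambda>x y. V x y - U x y)"
proof -
  have "\<bar>LINT (x, y)|(N \<Otimes>\<^sub>M N). (U x y - V x y) * f x * g y\<bar>
      = \<bar>LINT (x, y)|(N \<Otimes>\<^sub>M N). (V x y - U x y) * f x * g y\<bar>" for f g
  proof -
    have "(\<lambda>(x, y). (U x y - V x y) * f x * g y) = (\<lambda>p. - (case p of (x, y) \<Rightarrow> (V x y - U x y) * f x * g y))"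
      by (auto simp: algebra_simps)
    then show ?thesis by simp
  qed
  then show ?thesis by (simp add: cut_norm_def)
qed

lemma cut_dist_nonneg:
  fixes M :: "'a measure" and N :: "'b measure"
  assumes "prob_kernel M W" "prob_kernel N V"
  shows "0 \<le> cut_dist M W N V"
proof (rule ccontr)
  interpret M: prob_kernel M W by fact
  interpret N: prob_kernel N V by fact
  assume "\<not> 0 \<le> cut_dist M W N V"
  then have "cut_dist M W N V < 0" by simp
  from ex_coupling_near_cut_dist[OF M.prob_space_axioms N.prob_space_axioms this]
  obtain Q :: "('a \<times> 'b) measure" and \<phi> \<psi> where Q: "prob_space Q"
    and mp: "measure_preserving Q M \<phi>" "measure_preserving Q N \<psi>"
    and neg: "cut_norm Q (\<lambda>x y. pullback W \<phi> x y - pullback V \<psi> x y) < 0" by blast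
  have "0 \<le> cut_norm Q (\<lambda>x y. pullback W \<phi> x y - pullback V \<psi> x y)"
    by (rule cut_norm_nonneg[OF Q kernel_diff_bound[OF M.kernel N.kernel mp]])
  with neg show False by simp
qed

lemma kernel_equivI:
  assumes "prob_kernel M W" "prob_kernel N V" "\<And>e. e > 0 \<Longrightarrow> cut_dist M W N V \<le> e"
  shows "kernel_equiv M W N V"
proof -
  have "cut_dist M W N V \<le> 0" by (rule field_le_epsilon) (use assms(3) in simp)
  with cut_dist_nonneg[OF assms(1,2)] show ?thesis by (simp add: kernel_equiv_def)
qed

text \<open>The space \<open>M\<close> itself, with the identity and \<open>\<phi>\<close>, is an
  optimal coupling: its cut norm is bounded by an L1 norm that vanishes.\<close>

lemma kernel_equiv_pullback:
  assumes MW: "prob_kernel M W" and NV: "prob_kernel N V" and mp: "measure_preserving M N \<phi>"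
    and ae: "AE p in M \<Otimes>\<^sub>M M. W (fst p) (snd p) = V (\<phi> (fst p)) (\<phi> (snd p))"
  shows "kernel_equiv M W N V"
proof -
  interpret M: prob_kernel M W by fact
  interpret N: prob_kernel N V by fact
  have [measurable]: "\<phi> \<in> measurable M N" using mp by (simp add: measure_preserving_def)
  have idm: "measure_preserving M M (\<lambda>x. x)" by (simp add: measure_preserving_def)
  have "cut_dist M W N V \<le> cut_norm M (\<lambda>x y. pullback W (\<lambda>x. x) x y - pullback V \<phi> x y)"
    by (rule cut_dist_le[OF M.kernel N.kernel M.prob_space_axioms idm mp])
  also have "\<dots> \<le> (LINT p|(M \<Otimes>\<^sub>M M). \<bar>pullback W (\<lambda>x. x) (fst p) (snd p) - pullback V \<phi> (fst p) (snd p)\<bar>)"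
  proof (rule cut_norm_le_L1[OF M.prob_space_axioms _ kernel_diff_bound[OF M.kernel N.kernel idm mp]])
    show "(\<lambda>p. pullback W (\<lambda>x. x) (fst p) (snd p) - pullback V \<phi> (fst p) (snd p)) \<in> borel_measurable (M \<Otimes>\<^sub>M M)"
      unfolding pullback_def by measurable
  qed
  also have "\<dots> = 0"
    by (rule integral_eq_zero_AE) (use ae in \<open>auto simp: pullback_def\<close>)
  finally show ?thesis
    using cut_dist_nonneg[OF MW NV] by (simp add: kernel_equiv_def)
qed

lemma kernel_equiv_sym:
  fixes M :: "'a measure" and N :: "'b measure"
  assumes MW: "prob_kernel M W" and NV: "prob_kernel N V" and eq: "kernel_equiv M W N V"
  shows "kernel_equiv N V M W"
proof (rule kernel_equivI[OF NV MW])
  interpret M: prob_kernel M W by fact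
  interpret N: prob_kernel N V by fact
  fix e :: real assume "e > 0"
  then have "cut_dist M W N V < e" using eq by (simp add: kernel_equiv_def)
  from ex_coupling_near_cut_dist[OF M.prob_space_axioms N.prob_space_axioms this]
  obtain Q :: "('a \<times> 'b) measure" and \<phi> \<psi> where Q: "prob_space Q"
    and mp: "measure_preserving Q M \<phi>" "measure_preserving Q N \<psi>"
    and cut: "cut_norm Q (\<lambda>x y. pullback W \<phi> x y - pullback V \<psi> x y) < e" by blast
  show "cut_dist N V M W \<le> e"
    using cut_dist_le[OF N.kernel M.kernel Q mp(2,1)] cut
      cut_norm_diff_commute[of Q "pullback W \<phi>" "pullback V \<psi>"] by simp
qed

section \<open>Gluing couplings along a partition and transitivity\<close>

lemma pred_nat_eq:
  fixes f g :: "'a \<Rightarrow> nat"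
  assumes [measurable]: "f \<in> measurable K (count_space UNIV)" "g \<in> measurable K (count_space UNIV)"
  shows "{x \<in> space K. f x = g x} \<in> sets K"
proof -
  have "{x \<in> space K. real (f x) = real (g x)} \<in> sets K" by measurable
  then show ?thesis by simp
qed

text \<open>The weight \<open>1 / p i\<close> on a cell of mass \<open>p i\<close> integrates to 1;
  this is what leaves both marginals of the glued coupling unchanged.\<close>

lemma nn_integral_glue_density:
  fixes \<pi> :: "'a \<Rightarrow> nat"
  assumes "prob_space M" and mp: "measure_preserving Q M \<beta>"
    and [measurable]: "\<pi> \<in> measurable M (count_space UNIV)"
    and p: "p = (\<lambda>i. measure M {x\<in>space M. \<pi> x = i})" and pos: "0 < p i"
  shows "(\<integral>\<^sup>+b. (if i = \<pi> (\<beta> b) then ennreal (1 / p i) else 0) \<partial>Q) = 1"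
proof -
  interpret M: prob_space M by fact
  have [measurable]: "\<beta> \<in> measurable Q M" and d: "distr Q M \<beta> = M"
    using mp by (auto simp: measure_preserving_def)
  have "(\<integral>\<^sup>+b. (if i = \<pi> (\<beta> b) then ennreal (1 / p i) else 0) \<partial>Q)
      = (\<integral>\<^sup>+x. (if i = \<pi> x then ennreal (1 / p i) else 0) \<partial>distr Q M \<beta>)"
    by (subst nn_integral_distr) auto
  also have "\<dots> = (\<integral>\<^sup>+x. ennreal (1 / p i) * indicator {x\<in>space M. \<pi> x = i} x \<partial>M)"
    unfolding d by (intro nn_integral_cong) (auto simp: indicator_def)
  also have "\<dots> = ennreal (1 / p i) * ennreal (p i)"
    by (subst nn_integral_cmult_indicator) (auto simp: p M.emeasure_eq_measure)
  also have "\<dots> = 1"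
    using pos by (simp flip: ennreal_mult)
  finally show ?thesis .
qed

text \<open>The coupling that is independent conditionally on the cell of the partition \<open>\<pi>\<close>.\<close>

lemma glue_couplings:
  fixes Q1 :: "'c measure" and Q2 :: "'d measure" and \<pi> :: "'a \<Rightarrow> nat"
  assumes Q1: "prob_space Q1" and Q2: "prob_space Q2" and M: "prob_space M"
    and mp: "measure_preserving Q1 M \<alpha>" "measure_preserving Q2 M \<beta>"
    and \<pi>[measurable]: "\<pi> \<in> measurable M (count_space UNIV)"
  shows "\<exists>R :: ('c \<times> 'd) measure. prob_space R \<and> measure_preserving R Q1 fst \<and>
    measure_preserving R Q2 snd \<and> (AE r in R. \<pi> (\<alpha> (fst r)) = \<pi> (\<beta> (snd r)))"
proof -
  interpret Q1: prob_space Q1 by fact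
  interpret Q2: prob_space Q2 by fact
  interpret M: prob_space M by fact
  interpret P: pair_prob_space Q1 Q2 ..
  have \<alpha>[measurable]: "\<alpha> \<in> measurable Q1 M" and \<beta>[measurable]: "\<beta> \<in> measurable Q2 M"
    and d: "distr Q1 M \<alpha> = M" "distr Q2 M \<beta> = M"
    using mp by (auto simp: measure_preserving_def)
  define p where "p = (\<lambda>i. measure M {x\<in>space M. \<pi> x = i})"
  \<comment> \<open>Density with respect to the product measure: pairs in a common cell are
    reweighted, all others removed. In a cell of mass zero the weight is \<open>1 / 0 = 0\<close>,
    but such cells are met with probability zero.\<close>
  define h where "h = (\<lambda>r. if \<pi> (\<alpha> (fst r)) = \<pi> (\<beta> (snd r)) then ennreal (1 / p (\<pi> (\<alpha> (fst r)))) else 0)"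
  have hk: "(\<lambda>r. ennreal (1 / p (\<pi> (\<alpha> (fst r))))) \<in> borel_measurable (Q1 \<Otimes>\<^sub>M Q2)"
    by (rule measurable_compose[where N = "count_space UNIV" and f = "\<lambda>r. \<pi> (\<alpha> (fst r))"]) auto
  have h[measurable]: "h \<in> borel_measurable (Q1 \<Otimes>\<^sub>M Q2)" unfolding h_def
    by (rule measurable_If[OF hk measurable_const pred_nat_eq]) (simp, measurable)
  have "AE x in M. \<forall>i. p i = 0 \<longrightarrow> \<pi> x \<noteq> i"
  proof (subst AE_all_countable, rule)
    fix i
    have "{x\<in>space M. \<pi> x = i} \<in> sets M" by measurable
    from M.prob_Collect_eq_0[OF this] show "AE x in M. p i = 0 \<longrightarrow> \<pi> x \<noteq> i"
      by (cases "p i = 0") (auto simp: p_def)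
  qed
  then have pos: "AE x in M. 0 < p (\<pi> x)"
    by eventually_elim (auto simp: p_def less_le)
  then have pos1: "AE a in Q1. 0 < p (\<pi> (\<alpha> a))"
    by (rule AE_distrD[OF \<alpha>, unfolded d])
  have pos2: "AE b in Q2. 0 < p (\<pi> (\<beta> b))"
    using pos by (rule AE_distrD[OF \<beta>, unfolded d])
  define R where "R = density (Q1 \<Otimes>\<^sub>M Q2) h"
  have [simp, measurable_cong]: "sets R = sets (Q1 \<Otimes>\<^sub>M Q2)" by (simp add: R_def)
  have [simp]: "space R = space (Q1 \<Otimes>\<^sub>M Q2)" by (simp add: R_def)
  have R1: "distr R Q1 fst = Q1"
  proof (rule measure_eqI)
    fix B assume "B \<in> sets (distr R Q1 fst)"
    then have B[measurable]: "B \<in> sets Q1" by simp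
    have "emeasure (distr R Q1 fst) B = emeasure R (fst -` B \<inter> space R)"
      by (rule emeasure_distr) measurable
    also have "\<dots> = (\<integral>\<^sup>+r. h r * indicator (fst -` B \<inter> space R) r \<partial>(Q1 \<Otimes>\<^sub>M Q2))"
      unfolding R_def by (rule emeasure_density) auto
    also have "\<dots> = (\<integral>\<^sup>+r. indicator B (fst r) * h r \<partial>(Q1 \<Otimes>\<^sub>M Q2))"
      by (intro nn_integral_cong) (auto simp: indicator_def)
    also have "\<dots> = (\<integral>\<^sup>+a. \<integral>\<^sup>+b. indicator B a * h (a, b) \<partial>Q2 \<partial>Q1)"
      by (subst Q2.nn_integral_fst[symmetric]) auto
    also have "\<dots> = (\<integral>\<^sup>+a. indicator B a \<partial>Q1)"
    proof (rule nn_integral_cong_AE)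
      show "AE a in Q1. (\<integral>\<^sup>+b. indicator B a * h (a, b) \<partial>Q2) = indicator B a"
        using pos1 AE_space
      proof eventually_elim
        case (elim a)
        have "(\<integral>\<^sup>+b. h (a, b) \<partial>Q2) = 1"
          using nn_integral_glue_density[OF M mp(2) \<pi> p_def elim(1)]
          by (simp only: h_def fst_conv snd_conv)
        then show ?case
          using elim(2) by (subst nn_integral_cmult) auto
      qed
    qed
    finally show "emeasure (distr R Q1 fst) B = emeasure Q1 B" by simp
  qed simp
  have R2: "distr R Q2 snd = Q2"
  proof (rule measure_eqI)
    fix B assume "B \<in> sets (distr R Q2 snd)"
    then have B[measurable]: "B \<in> sets Q2" by simp
    have "emeasure (distr R Q2 snd) B = emeasure R (snd -` B \<inter> space R)"
      by (rule emeasure_distr) measurable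
    also have "\<dots> = (\<integral>\<^sup>+r. h r * indicator (snd -` B \<inter> space R) r \<partial>(Q1 \<Otimes>\<^sub>M Q2))"
      unfolding R_def by (rule emeasure_density) auto
    also have "\<dots> = (\<integral>\<^sup>+r. indicator B (snd r) * h r \<partial>(Q1 \<Otimes>\<^sub>M Q2))"
      by (intro nn_integral_cong) (auto simp: indicator_def)
    also have "\<dots> = (\<integral>\<^sup>+b. \<integral>\<^sup>+a. indicator B b * h (a, b) \<partial>Q1 \<partial>Q2)"
      by (subst P.nn_integral_snd[symmetric]) auto
    also have "\<dots> = (\<integral>\<^sup>+b. indicator B b \<partial>Q2)"
    proof (rule nn_integral_cong_AE)
      show "AE b in Q2. (\<integral>\<^sup>+a. indicator B b * h (a, b) \<partial>Q1) = indicator B b"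
        using pos2 AE_space
      proof eventually_elim
        case (elim b)
        have "(\<integral>\<^sup>+a. h (a, b) \<partial>Q1)
            = (\<integral>\<^sup>+a. (if \<pi> (\<beta> b) = \<pi> (\<alpha> a) then ennreal (1 / p (\<pi> (\<beta> b))) else 0) \<partial>Q1)"
          by (intro nn_integral_cong) (auto simp: h_def)
        also have "\<dots> = 1"
          by (rule nn_integral_glue_density[OF M mp(1) \<pi> p_def elim(1)])
        finally show ?case
          using elim(2) by (subst nn_integral_cmult) auto
      qed
    qed
    finally show "emeasure (distr R Q2 snd) B = emeasure Q2 B" by simp
  qed simp
  have "prob_space R"
    by (rule prob_space_distrD[of fst R Q1]) (auto simp: R1 Q1)
  moreover have "AE r in R. \<pi> (\<alpha> (fst r)) = \<pi> (\<beta> (snd r))"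
    unfolding R_def by (subst AE_density[OF h]) (auto simp: h_def split: if_splits)
  ultimately show ?thesis
    using R1 R2 by (intro exI[of _ R]) (auto simp: measure_preserving_def)
qed

text \<open>On the glued space the two points of \<open>M\<close> need not coincide, but they share
  a cell. A step function constant on these cells takes the same value at both, so the two pullbacks
  of \<open>W\<close> differ in L1 by at most twice the approximation error. The budget is
  \<open>e / 4\<close> for each coupling and \<open>e / 2\<close> in the middle;
  \<open>cut_dist_le\<close> admits the larger carrier type.\<close>

lemma kernel_equiv_trans:
  fixes A :: "'a measure" and M :: "'b measure" and B :: "'c measure"
  assumes AU: "prob_kernel A U" and MW: "prob_kernel M W" and BV: "prob_kernel B V"
    and eq: "kernel_equiv A U M W" "kernel_equiv M W B V"
  shows "kernel_equiv A U B V"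
proof (rule kernel_equivI[OF AU BV])
  interpret A: prob_kernel A U by fact
  interpret M: prob_kernel M W by fact
  interpret B: prob_kernel B V by fact
  fix e :: real assume "e > 0"
  then have e4: "e / 4 > 0" by simp
  have W_int: "integrable (M \<Otimes>\<^sub>M M) (\<lambda>p. W (fst p) (snd p))"
    using M.kernel_bounds
    by (intro integrable_pair_bounded[where B = 1] M.prob_space_axioms M.kernel_measurable) auto
  from step_approximable_integrable[OF M.prob_space_axioms M.prob_space_axioms this] e4
  obtain \<pi>1 \<pi>2 :: "'b \<Rightarrow> nat" and T where
    m[measurable]: "\<pi>1 \<in> measurable M (count_space UNIV)" "\<pi>2 \<in> measurable M (count_space UNIV)"
    and fin: "finite (range \<pi>1)" "finite (range \<pi>2)"
    and approx: "(LINT p|(M \<Otimes>\<^sub>M M). \<bar>W (fst p) (snd p) - T (\<pi>1 (fst p)) (\<pi>2 (snd p))\<bar>) < e / 4"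
    unfolding step_approximable_def by meson
  \<comment> \<open>The approximation uses different partitions for rows and columns; a point must
    stay in its cell of both, so the gluing is done along their common refinement.\<close>
  define \<pi> where "\<pi> = (\<lambda>x. prod_encode (\<pi>1 x, \<pi>2 x))"
  have \<pi>[measurable]: "\<pi> \<in> measurable M (count_space UNIV)" unfolding \<pi>_def by measurable
  define S where "S = (\<lambda>x y. T (\<pi>1 x) (\<pi>2 y))"
  have S_int: "integrable (M \<Otimes>\<^sub>M M) (\<lambda>p. S (fst p) (snd p))"
    unfolding S_def by (rule step_function_integrable[OF M.prob_space_axioms M.prob_space_axioms m fin])
  have WS_int: "integrable (M \<Otimes>\<^sub>M M) (\<lambda>p. \<bar>W (fst p) (snd p) - S (fst p) (snd p)\<bar>)"
    using W_int S_int by simp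
  have "cut_dist A U M W < e / 4" using eq(1) e4 by (simp add: kernel_equiv_def)
  from ex_coupling_near_cut_dist[OF A.prob_space_axioms M.prob_space_axioms this]
  obtain Q1 :: "('a \<times> 'b) measure" and \<phi> \<alpha> where Q1: "prob_space Q1"
    and mp1: "measure_preserving Q1 A \<phi>" "measure_preserving Q1 M \<alpha>"
    and cut1: "cut_norm Q1 (\<lambda>x y. pullback U \<phi> x y - pullback W \<alpha> x y) < e / 4" by blast
  have "cut_dist M W B V < e / 4" using eq(2) e4 by (simp add: kernel_equiv_def)
  from ex_coupling_near_cut_dist[OF M.prob_space_axioms B.prob_space_axioms this]
  obtain Q2 :: "('b \<times> 'c) measure" and \<beta> \<psi> where Q2: "prob_space Q2"
    and mp2: "measure_preserving Q2 M \<beta>" "measure_preserving Q2 B \<psi>"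
    and cut2: "cut_norm Q2 (\<lambda>x y. pullback W \<beta> x y - pullback V \<psi> x y) < e / 4" by blast
  from glue_couplings[OF Q1 Q2 M.prob_space_axioms mp1(2) mp2(1) \<pi>]
  obtain R :: "(('a \<times> 'b) \<times> 'b \<times> 'c) measure" where R: "prob_space R"
    and f: "measure_preserving R Q1 fst" and s: "measure_preserving R Q2 snd"
    and cells: "AE r in R. \<pi> (\<alpha> (fst r)) = \<pi> (\<beta> (snd r))" by blast
  interpret R: prob_space R by fact
  interpret RR: pair_prob_space R R ..
  note mpR = measure_preserving_compose[OF f mp1(1)] measure_preserving_compose[OF f mp1(2)]
    measure_preserving_compose[OF s mp2(1)] measure_preserving_compose[OF s mp2(2)]
  have [measurable]: "(\<lambda>r. \<phi> (fst r)) \<in> measurable R A" "(\<lambda>r. \<alpha> (fst r)) \<in> measurable R M"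
    "(\<lambda>r. \<beta> (snd r)) \<in> measurable R M" "(\<lambda>r. \<psi> (snd r)) \<in> measurable R B"
    using mpR by (auto simp: measure_preserving_def)
  have [measurable]: "\<phi> \<in> measurable Q1 A" "\<alpha> \<in> measurable Q1 M" "\<beta> \<in> measurable Q2 M" "\<psi> \<in> measurable Q2 B"
    using mp1 mp2 by (auto simp: measure_preserving_def)
  define U' where "U' = pullback U (\<lambda>r :: ('a \<times> 'b) \<times> 'b \<times> 'c. \<phi> (fst r))"
  define W1 where "W1 = pullback W (\<lambda>r :: ('a \<times> 'b) \<times> 'b \<times> 'c. \<alpha> (fst r))"
  define W2 where "W2 = pullback W (\<lambda>r :: ('a \<times> 'b) \<times> 'b \<times> 'c. \<beta> (snd r))"
  define V' where "V' = pullback V (\<lambda>r :: ('a \<times> 'b) \<times> 'b \<times> 'c. \<psi> (snd r))"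
  have meas[measurable]: "(\<lambda>p. U' (fst p) (snd p)) \<in> borel_measurable (R \<Otimes>\<^sub>M R)"
    "(\<lambda>p. W1 (fst p) (snd p)) \<in> borel_measurable (R \<Otimes>\<^sub>M R)"
    "(\<lambda>p. W2 (fst p) (snd p)) \<in> borel_measurable (R \<Otimes>\<^sub>M R)"
    "(\<lambda>p. V' (fst p) (snd p)) \<in> borel_measurable (R \<Otimes>\<^sub>M R)"
    unfolding U'_def W1_def W2_def V'_def pullback_def by measurable
  have b1: "\<bar>U' x y - W1 x y\<bar> \<le> 1" and b2: "\<bar>W1 x y - W2 x y\<bar> \<le> 1" and b3: "\<bar>W2 x y - V' x y\<bar> \<le> 1"
    if "x \<in> space R" "y \<in> space R" for x y
    using kernel_diff_bound[OF A.kernel M.kernel mpR(1,2) that]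
      kernel_diff_bound[OF M.kernel M.kernel mpR(2,3) that]
      kernel_diff_bound[OF M.kernel B.kernel mpR(3,4) that]
    by (auto simp: U'_def W1_def W2_def V'_def)
  have b23: "\<bar>W1 x y - W2 x y + (W2 x y - V' x y)\<bar> \<le> 2" if "x \<in> space R" "y \<in> space R" for x y
    using b2[OF that] b3[OF that] by linarith
  have "cut_norm R (\<lambda>x y. U' x y - W1 x y) < e / 4"
  proof -
    have "cut_norm R (pullback (\<lambda>x y. pullback U \<phi> x y - pullback W \<alpha> x y) fst)
        \<le> cut_norm Q1 (\<lambda>x y. pullback U \<phi> x y - pullback W \<alpha> x y)"
    proof (rule cut_norm_pullback_le[OF R Q1 f _ kernel_diff_bound[OF A.kernel M.kernel mp1]])
      show "(\<lambda>p. pullback U \<phi> (fst p) (snd p) - pullback W \<alpha> (fst p) (snd p)) \<in> borel_measurable (Q1 \<Otimes>\<^sub>M Q1)"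
        unfolding pullback_def by measurable
    qed
    then show ?thesis using cut1 by (simp add: U'_def W1_def pullback_def)
  qed
  moreover have "cut_norm R (\<lambda>x y. W2 x y - V' x y) < e / 4"
  proof -
    have "cut_norm R (pullback (\<lambda>x y. pullback W \<beta> x y - pullback V \<psi> x y) snd)
        \<le> cut_norm Q2 (\<lambda>x y. pullback W \<beta> x y - pullback V \<psi> x y)"
    proof (rule cut_norm_pullback_le[OF R Q2 s _ kernel_diff_bound[OF M.kernel B.kernel mp2]])
      show "(\<lambda>p. pullback W \<beta> (fst p) (snd p) - pullback V \<psi> (fst p) (snd p)) \<in> borel_measurable (Q2 \<Otimes>\<^sub>M Q2)"
        unfolding pullback_def by measurable
    qed
    then show ?thesis using cut2 by (simp add: W2_def V'_def pullback_def)
  qed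
  moreover have "cut_norm R (\<lambda>x y. W1 x y - W2 x y) < e / 2"
  proof -
    let ?d = "\<lambda>p. \<bar>W (fst p) (snd p) - S (fst p) (snd p)\<bar>"
    let ?a = "\<lambda>p. (\<alpha> (fst (fst p)), \<alpha> (fst (snd p)))"
    let ?b = "\<lambda>p. (\<beta> (snd (fst p)), \<beta> (snd (snd p)))"
    have mpa: "measure_preserving (R \<Otimes>\<^sub>M R) (M \<Otimes>\<^sub>M M) ?a" and mpb: "measure_preserving (R \<Otimes>\<^sub>M R) (M \<Otimes>\<^sub>M M) ?b"
      using measure_preserving_pair[OF R M.prob_space_axioms mpR(2)]
        measure_preserving_pair[OF R M.prob_space_axioms mpR(3)] by auto
    have "AE p in R \<Otimes>\<^sub>M R. \<pi> (\<alpha> (fst (fst p))) = \<pi> (\<beta> (snd (fst p))) \<and>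
        \<pi> (\<alpha> (fst (snd p))) = \<pi> (\<beta> (snd (snd p)))"
    proof (rule RR.AE_pair_measure)
      show "AE x in R. AE y in R. \<pi> (\<alpha> (fst (fst (x, y)))) = \<pi> (\<beta> (snd (fst (x, y)))) \<and>
        \<pi> (\<alpha> (fst (snd (x, y)))) = \<pi> (\<beta> (snd (snd (x, y))))"
        using cells by eventually_elim (use cells in simp)
      define a b
        where "a = (\<lambda>r :: ('a \<times> 'b) \<times> 'b \<times> 'c. \<pi> (\<alpha> (fst r)))"
          and "b = (\<lambda>r :: ('a \<times> 'b) \<times> 'b \<times> 'c. \<pi> (\<beta> (snd r)))"
      have [measurable]: "a \<in> measurable R (count_space UNIV)" "b \<in> measurable R (count_space UNIV)"
        unfolding a_def b_def by measurable
      have "{p \<in> space (R \<Otimes>\<^sub>M R). a (fst p) = b (fst p) \<and> a (snd p) = b (snd p)} \<in> sets (R \<Otimes>\<^sub>M R)"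
        by (intro sets.sets_Collect_conj pred_nat_eq) measurable
      then show "{p \<in> space (R \<Otimes>\<^sub>M R). \<pi> (\<alpha> (fst (fst p))) = \<pi> (\<beta> (snd (fst p))) \<and>
        \<pi> (\<alpha> (fst (snd p))) = \<pi> (\<beta> (snd (snd p)))} \<in> sets (R \<Otimes>\<^sub>M R)"
        by (simp add: a_def b_def)
    qed
    then have "AE p in R \<Otimes>\<^sub>M R. \<bar>W1 (fst p) (snd p) - W2 (fst p) (snd p)\<bar> \<le> ?d (?a p) + ?d (?b p)"
    proof eventually_elim
      case (elim p)
      then have "S (fst (?a p)) (snd (?a p)) = S (fst (?b p)) (snd (?b p))"
        by (simp add: S_def \<pi>_def)
      then show ?case by (simp add: W1_def W2_def pullback_def)
    qed
    moreover have "integrable (R \<Otimes>\<^sub>M R) (\<lambda>p. \<bar>W1 (fst p) (snd p) - W2 (fst p) (snd p)\<bar>)"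
      using b2 by (intro integrable_pair_bounded[OF R R, where B = 1]) auto
    moreover note ia = measure_preserving_integrable[OF mpa WS_int]
      and ib = measure_preserving_integrable[OF mpb WS_int]
    ultimately have "(LINT p|(R \<Otimes>\<^sub>M R). \<bar>W1 (fst p) (snd p) - W2 (fst p) (snd p)\<bar>)
        \<le> (LINT p|(R \<Otimes>\<^sub>M R). ?d (?a p) + ?d (?b p))"
      by (intro integral_mono_AE Bochner_Integration.integrable_add)
    also have "\<dots> = (LINT p|(R \<Otimes>\<^sub>M R). ?d (?a p)) + (LINT p|(R \<Otimes>\<^sub>M R). ?d (?b p))"
      by (rule Bochner_Integration.integral_add[OF ia ib])
    also have "\<dots> = (LINT p|(M \<Otimes>\<^sub>M M). ?d p) + (LINT p|(M \<Otimes>\<^sub>M M). ?d p)"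
      using WS_int measure_preserving_integral[OF mpa, of ?d] measure_preserving_integral[OF mpb, of ?d]
      by (simp only: borel_measurable_integrable)
    also have "\<dots> < e / 2" using approx by (simp add: S_def)
    finally have "(LINT p|(R \<Otimes>\<^sub>M R). \<bar>W1 (fst p) (snd p) - W2 (fst p) (snd p)\<bar>) < e / 2" .
    moreover have "cut_norm R (\<lambda>x y. W1 x y - W2 x y)
        \<le> (LINT p|(R \<Otimes>\<^sub>M R). \<bar>W1 (fst p) (snd p) - W2 (fst p) (snd p)\<bar>)"
      by (rule cut_norm_le_L1[OF R _ b2]) measurable
    ultimately show ?thesis by linarith
  qed
  moreover have "cut_norm R (\<lambda>x y. (U' x y - W1 x y) + ((W1 x y - W2 x y) + (W2 x y - V' x y)))
      \<le> cut_norm R (\<lambda>x y. U' x y - W1 x y) + cut_norm R (\<lambda>x y. (W1 x y - W2 x y) + (W2 x y - V' x y))"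
    by (rule cut_norm_triangle[OF R _ _ b1 b23]) measurable
  moreover have "cut_norm R (\<lambda>x y. (W1 x y - W2 x y) + (W2 x y - V' x y))
      \<le> cut_norm R (\<lambda>x y. W1 x y - W2 x y) + cut_norm R (\<lambda>x y. W2 x y - V' x y)"
    by (rule cut_norm_triangle[OF R _ _ b2 b3]) measurable
  moreover have "cut_dist A U B V \<le> cut_norm R (\<lambda>x y. U' x y - V' x y)"
    unfolding U'_def V'_def by (rule cut_dist_le[OF A.kernel B.kernel R mpR(1,4)])
  ultimately show "cut_dist A U B V \<le> e" by simp
qed

section \<open>The monotone kernel on the unit interval\<close>

context prob_kernel
begin

abbreviation degree_law :: "real measure" where
  "degree_law \<equiv> distr M borel degree"

lemma prob_kernel_profile: "prob_kernel degree_law profile"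
proof (rule prob_kernelI)
  show "prob_space degree_law" by (rule prob_space_distr) simp
  have "sets (degree_law \<Otimes>\<^sub>M degree_law) = sets (borel \<Otimes>\<^sub>M borel)" by (intro sets_pair_measure_cong) auto
  then have "(\<lambda>p. profile (fst p) (snd p)) \<in> borel_measurable (degree_law \<Otimes>\<^sub>M degree_law)"
    using profile_measurable measurable_cong_sets by blast
  then show "kernel_on degree_law profile"
    using profile_bounds profile_sym unfolding kernel_on_def by (auto simp: case_prod_beta')
qed

text \<open>The degree maps \<open>M\<close> onto its own law measure-preservingly, and almost
  everywhere \<open>W\<close> is the pullback of \<open>profile\<close>.\<close>

lemma kernel_equiv_profile:
  assumes degree_monotone
  shows "kernel_equiv M W degree_law profile"
proof (rule kernel_equiv_pullback[OF prob_kernel_axioms prob_kernel_profile])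
  show "measure_preserving M degree_law degree"
    by (auto simp: measure_preserving_def intro!: distr_cong)
qed (rule kernel_eq_profile[OF assms])

lemma monotone_kernel_degree_order:
  assumes r: "measurable_order M r"
  shows "monotone_kernel M (degree_order r) (\<lambda>x y. profile (degree x) (degree y))"
proof -
  have "(\<lambda>p. (degree (fst p), degree (snd p))) \<in> measurable (M \<Otimes>\<^sub>M M) (borel \<Otimes>\<^sub>M borel)" by measurable
  from measurable_compose[OF this profile_measurable]
  have "kernel_on M (\<lambda>x y. profile (degree x) (degree y))"
    using profile_bounds profile_sym unfolding kernel_on_def by (auto simp: case_prod_beta')
  moreover have "degree x \<le> degree y" if "(x, y) \<in> (degree_order r)\<^sup>=" for x y
    using that by (auto simp: degree_order_def)
  ultimately show ?thesis
    unfolding monotone_kernel_def by (auto intro!: profile_mono)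
qed

text \<open>Pseudoinverse of the distribution function of the degree. Outside (0,1) the infimum may
  run over all reals or over the empty set; the values 0 and 1 bound the range of the degree and
  keep the function monotone on the whole line.\<close>

definition quantile :: "real \<Rightarrow> real" where
  "quantile s = (if s \<le> 0 then 0 else if 1 \<le> s then 1 else Inf {x. s \<le> cdf degree_law x})"

lemma cdf_distribution_degree_law: "cdf_distribution degree_law"
  using prob_space_distr[of degree borel]
  by (simp add: cdf_distribution_def real_distribution_def real_distribution_axioms_def)

lemma Inf_cdf_bounds:
  assumes s: "0 < s" "s < 1"
  shows "0 \<le> Inf {x. s \<le> cdf degree_law x} \<and> Inf {x. s \<le> cdf degree_law x} \<le> 1"
proof -
  interpret C: cdf_distribution degree_law by (rule cdf_distribution_degree_law)
  have cdf: "cdf degree_law x = measure M {y \<in> space M. degree y \<le> x}" for x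
    by (simp add: cdf_def measure_distr vimage_def Int_def conj_commute)
  have "{y \<in> space M. degree y \<le> 1} = space M" using mass_bounds[of "space M"] by auto
  then have "s \<le> cdf degree_law 1" using s by (simp add: cdf prob_space)
  then have "Inf {x. s \<le> cdf degree_law x} \<le> 1" by (rule C.pseudoinverse[OF s, THEN iffD1])
  moreover have "0 \<le> Inf {x. s \<le> cdf degree_law x}"
  proof (rule ccontr)
    assume neg: "\<not> 0 \<le> Inf {x. s \<le> cdf degree_law x}"
    define x where "x = Inf {x. s \<le> cdf degree_law x}"
    have "s \<le> cdf degree_law x" unfolding x_def by (rule C.pseudoinverse[OF s, THEN iffD2]) (rule order_refl)
    moreover have "{y \<in> space M. degree y \<le> x} = {}"
      using neg mass_bounds[of "space M"] by (force simp: x_def)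
    then have "cdf degree_law x = 0" by (simp only: cdf measure_empty)
    ultimately show False using s by simp
  qed
  ultimately show ?thesis by simp
qed

lemma quantile_mono: "s \<le> t \<Longrightarrow> quantile s \<le> quantile t"
proof -
  assume st: "s \<le> t"
  interpret C: cdf_distribution degree_law by (rule cdf_distribution_degree_law)
  show ?thesis
    using st Inf_cdf_bounds[of s] Inf_cdf_bounds[of t] C.mono_I
    by (auto simp: quantile_def mono_on_def)
qed

lemma quantile_measurable[measurable]: "quantile \<in> borel_measurable borel"
  by (rule borel_measurable_mono) (auto simp: mono_def quantile_mono)

text \<open>Inverse transform sampling: on (0,1) the pseudoinverse carries Lebesgue measure to the
  degree law, and the endpoints of the closed interval are null.\<close>

lemma measure_preserving_quantile: "measure_preserving unit_interval degree_law quantile"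
proof -
  interpret C: cdf_distribution degree_law by (rule cdf_distribution_degree_law)
  let ?I = "\<lambda>s. Inf {x. s \<le> cdf degree_law x}"
  have m: "quantile \<in> borel_measurable unit_interval"
    unfolding unit_interval_def by (intro measurable_restrict_space1) simp
  have "distr unit_interval borel quantile = distr (restrict_space lborel {0<..<1}) borel ?I"
  proof (rule measure_eqI)
    fix B :: "real set" assume "B \<in> sets (distr unit_interval borel quantile)"
    then have B[measurable]: "B \<in> sets borel" by simp
    have mI: "?I \<in> borel_measurable (restrict_space lborel {0<..<1})"
      using C.measurable_CI by (simp add: measurable_def sets_restrict_space)
    have "emeasure (distr unit_interval borel quantile) B = emeasure unit_interval (quantile -` B \<inter> {0..1})"
      using emeasure_distr[OF m B] by (simp add: unit_interval_def space_restrict_space)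
    also have "\<dots> = emeasure lborel (quantile -` B \<inter> {0..1})"
      unfolding unit_interval_def by (rule emeasure_restrict_space) auto
    also have "\<dots> = emeasure lborel (?I -` B \<inter> {0<..<1})"
    proof (rule emeasure_eq_AE)
      have "AE s in lborel. s \<noteq> 0" "AE s in lborel. s \<noteq> (1 :: real)"
        by (rule AE_lborel_singleton)+
      then show "AE s in lborel. s \<in> quantile -` B \<inter> {0..1} \<longleftrightarrow> s \<in> ?I -` B \<inter> {0<..<1}"
        by eventually_elim (auto simp: quantile_def)
      show "quantile -` B \<inter> {0..1} \<in> sets lborel"
        using measurable_sets[OF quantile_measurable B] by auto
      show "?I -` B \<inter> {0<..<1} \<in> sets lborel"
        using measurable_sets[OF mI B] by (simp add: sets_restrict_space_iff space_restrict_space)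
    qed
    also have "\<dots> = emeasure (restrict_space lborel {0<..<1}) (?I -` B \<inter> {0<..<1})"
      by (rule emeasure_restrict_space[symmetric]) auto
    also have "\<dots> = emeasure (distr (restrict_space lborel {0<..<1}) borel ?I) B"
      using emeasure_distr[OF mI B] by (simp add: space_restrict_space)
    finally show "emeasure (distr unit_interval borel quantile) B
      = emeasure (distr (restrict_space lborel {0<..<1}) borel ?I) B" .
  qed simp
  also have "\<dots> = degree_law" by (rule C.distr_I_eq_M)
  finally have "distr unit_interval borel quantile = degree_law" .
  moreover have "distr unit_interval degree_law quantile = distr unit_interval borel quantile"
    by (rule distr_cong) auto
  ultimately show ?thesis
    using m by (simp add: measure_preserving_def)
qed

lemma monotone_kernel_quantile:
  "monotone_kernel unit_interval unit_order (\<lambda>s t. profile (quantile s) (quantile t))"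
proof -
  have [measurable]: "quantile \<in> borel_measurable unit_interval"
    unfolding unit_interval_def by (intro measurable_restrict_space1) simp
  have "(\<lambda>p. (quantile (fst p), quantile (snd p)))
      \<in> measurable (unit_interval \<Otimes>\<^sub>M unit_interval) (borel \<Otimes>\<^sub>M borel)" by measurable
  from measurable_compose[OF this profile_measurable]
  have "kernel_on unit_interval (\<lambda>s t. profile (quantile s) (quantile t))"
    using profile_bounds profile_sym unfolding kernel_on_def by (auto simp: case_prod_beta')
  then show ?thesis
    unfolding monotone_kernel_def unit_order_def by (auto intro!: profile_mono quantile_mono)
qed

text \<open>Both \<open>M\<close> and the unit interval map onto the degree law, so two pullback
  equivalences are joined there by symmetry and transitivity.\<close>

lemma kernel_equiv_quantile:
  assumes degree_monotone
  shows "kernel_equiv M W unit_interval (\<lambda>s t. profile (quantile s) (quantile t))"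
proof -
  have k: "prob_kernel unit_interval (\<lambda>s t. profile (quantile s) (quantile t))"
    using monotone_kernel_quantile ordered_prob_space_unit_interval
    by (auto intro!: prob_kernelI simp: monotone_kernel_def ordered_prob_space_def)
  have "kernel_equiv unit_interval (\<lambda>s t. profile (quantile s) (quantile t)) degree_law profile"
    by (rule kernel_equiv_pullback[OF k prob_kernel_profile measure_preserving_quantile]) simp
  then show ?thesis
    by (intro kernel_equiv_trans[OF prob_kernel_axioms prob_kernel_profile k
      kernel_equiv_profile[OF assms] kernel_equiv_sym[OF k prob_kernel_profile]])
qed

end

lemma kernel_equiv_AE_eq:
  assumes "prob_kernel M W" "prob_kernel M W'" "AE (x, y) in M \<Otimes>\<^sub>M M. W x y = W' x y"
  shows "kernel_equiv M W M W'"
  by (rule kernel_equiv_pullback[OF assms(1,2), of "\<lambda>x. x"])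
    (use assms(3) in \<open>auto simp: measure_preserving_def case_prod_beta'\<close>)

lemma graph_limit_eq:
  assumes MW: "prob_kernel M W" and NV: "prob_kernel N V" and eq: "kernel_equiv M W N V"
  shows "graph_limit M W = graph_limit N V"
proof -
  have "kernel_equiv M W K U \<longleftrightarrow> kernel_equiv N V K U" if KU: "prob_kernel K U" for K :: "real measure" and U
    using kernel_equiv_trans[OF MW NV KU eq] kernel_equiv_trans[OF NV MW KU kernel_equiv_sym[OF MW NV eq]] by blast
  then show ?thesis
    by (auto simp: graph_limit_def prob_kernelI)
qed

theorem theorem4p11:
  fixes M :: "'a measure" and W :: "'a \<Rightarrow> 'a \<Rightarrow> real"
  assumes "prob_space M"
    and "\<exists>r. measurable_order M r"
    and "kernel_on M W"
  shows
    "(Omega1 M W = 0 \<longleftrightarrow>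
       (\<exists>r W'. measurable_order M r \<and> monotone_kernel M r W' \<and>
          (AE (x, y) in M \<Otimes>\<^sub>M M. W x y = W' x y))) \<and>
     (Omega1 M W = 0 \<longleftrightarrow> equiv_monotone_kernel TYPE('a) M W) \<and>
     (equiv_monotone_kernel TYPE('b) M W \<longrightarrow> Omega1 M W = 0) \<and>
     (Omega1 M W = 0 \<longleftrightarrow>
       (\<exists>W'. monotone_kernel unit_interval unit_order W' \<and> kernel_equiv M W unit_interval W')) \<and>
     (Omega1 M W = 0 \<longleftrightarrow> monotone_graph_limit (graph_limit M W))"
proof -
  have MW: "prob_kernel M W" using assms(1,3) by (rule prob_kernelI)
  interpret prob_kernel M W by fact
  obtain r where r: "measurable_order M r" using assms(2) by blast
  have unit_kernel: "prob_kernel unit_interval V" if "monotone_kernel unit_interval unit_order V" for V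
    using that ordered_prob_space_unit_interval
    by (auto intro!: prob_kernelI simp: monotone_kernel_def ordered_prob_space_def)
  let ?ii = "\<exists>r W'. measurable_order M r \<and> monotone_kernel M r W' \<and>
    (AE (x, y) in M \<Otimes>\<^sub>M M. W x y = W' x y)"
  let ?iv = "\<exists>W'. monotone_kernel unit_interval unit_order W' \<and> kernel_equiv M W unit_interval W'"
  have i: "Omega1 M W = 0 \<longleftrightarrow> degree_monotone"
    using Omega1_eq_0_imp_degree_monotone[OF _ assms(2)] degree_monotone_imp_Omega1_eq_0[OF _ r] by blast
  have ii: ?ii if degree_monotone
    using measurable_order_degree_order[OF r] monotone_kernel_degree_order[OF r] kernel_eq_profile[OF that]
    by (intro exI[of _ "degree_order r"] exI[of _ "\<lambda>x y. profile (degree x) (degree y)"])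
      (simp add: case_prod_beta')
  \<comment> \<open>The monotone version lives on \<open>M\<close> itself, so the type
    \<open>'a\<close> already carries a suitable ordered probability space.\<close>
  have iii: "equiv_monotone_kernel TYPE('a) M W" if mono: ?ii
  proof -
    obtain r W' where r: "measurable_order M r" "monotone_kernel M r W'"
      and ae: "AE (x, y) in M \<Otimes>\<^sub>M M. W x y = W' x y" using mono by blast
    have "prob_kernel M W'"
      using r(2) assms(1) by (simp add: prob_kernelI monotone_kernel_def)
    then have "kernel_equiv M W M W'" using MW ae by (intro kernel_equiv_AE_eq)
    then show ?thesis
      using r assms(1) unfolding equiv_monotone_kernel_def ordered_prob_space_def by blast
  qed
  have iii_a: degree_monotone if "equiv_monotone_kernel TYPE('a) M W"
    using that equivalent_to_monotone_imp_degree_monotone[OF MW] unfolding equiv_monotone_kernel_def by blast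
  have iii_b: degree_monotone if "equiv_monotone_kernel TYPE('b) M W"
    using that equivalent_to_monotone_imp_degree_monotone[OF MW] unfolding equiv_monotone_kernel_def by blast
  have iv: "degree_monotone \<longleftrightarrow> ?iv"
    using monotone_kernel_quantile kernel_equiv_quantile
      equivalent_to_monotone_imp_degree_monotone[OF MW ordered_prob_space_unit_interval] by blast
  have v: "?iv \<longleftrightarrow> monotone_graph_limit (graph_limit M W)"
  proof
    assume ?iv
    then show "monotone_graph_limit (graph_limit M W)"
      using graph_limit_eq[OF MW unit_kernel] unfolding monotone_graph_limit_def by blast
  next
    assume "monotone_graph_limit (graph_limit M W)"
    then obtain V where V: "monotone_kernel unit_interval unit_order V"
      and eq: "graph_limit M W = graph_limit unit_interval V" unfolding monotone_graph_limit_def by blast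
    interpret V: prob_kernel unit_interval V by (rule unit_kernel[OF V])
    \<comment> \<open>By reflexivity \<open>V\<close> represents its own class; equality of the
      classes then makes it equivalent to \<open>W\<close>.\<close>
    have "(unit_interval, V) \<in> graph_limit unit_interval V"
      using kernel_equiv_AE_eq[OF unit_kernel[OF V] unit_kernel[OF V]] V.kernel V.prob_space_axioms
      by (simp add: graph_limit_def)
    then have "kernel_equiv M W unit_interval V" unfolding eq[symmetric] by (simp add: graph_limit_def)
    with V show ?iv by blast
  qed
  show ?thesis using i ii iii iii_a iii_b iv v by blast
qed

end
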